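(* For every subset $X \subseteq \{B,C,I,N,O,W\}$, the problem $\theta_{X\cup\{N\}}$ is polynomial-time reducible to $\theta_{X\cup\{B,N\}}$, i.e., $\theta_{X,N} \le_P \theta_{X,B,N}$.
   Context: Edge-based districting. An instance consists of an undirected graph $G=(V,E)$, a positive integer $p \le |E|$ (districts indexed $1,\dots,p$), positive edge weights $b_e$ ($e \in E$), real bounds $\Phi_l \le \bar b \le \Phi_u$ where $\bar b = \frac{1}{p}\sum_{e\in E} b_e$, and (when centers are not selected) given center nodes $c_1,\dots,c_p \in V$, not necessarily distinct. Let $d_{u,v}$ be the shortest-path distance with edge lengths $b_e$, and $d_{v,(j,k)} = \min(d_{v,j}, d_{v,k}) + \alpha\, b_{(j,k)}$ for a fixed $\alpha\in[0,1]$. Variables: $x_{i,e}$ and $w_{iv}$ ($w_{iv}=1$ iff $v$ is the center of district $i$). Constraint groups: (S, always present) $\sum_{i=1}^p x_{i,e}=1$ for all $e$, $\sum_{v\in V} w_{iv}=1$ for all $i$, $x_{i,e}\ge 0$, $w_{iv}\in\{0,1\}$; a node may be the center of several districts. (B) $\Phi_l \le \sum_{e\in E} b_e x_{i,e} \le \Phi_u$ for all $i$, where the bounds are given either in additive form $\Phi_u=(1+\tau)\bar b$, $\Phi_l=(1-\tau)\bar b$ with $\tau\ge 0$, or in multiplicative form $\Phi_u=\bar b/\tau$, $\Phi_l=\tau\bar b$ with $\tau\in(0,1]$. (C) for all $D\subseteq E$ and all $i$: $\sum_{e\in \delta(D)} x_{i,e} + \sum_{e\in D}(1-x_{i,e})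 + \sum_{v\in V_D} w_{iv}\ge 1$, where $V_D$ is the set of vertices incident to an edge of $D$ and $\delta(D)$ the set of edges of $E\setminus D$ with an endpoint in $V_D$. (I) $x_{i,e}\in\{0,1\}$; if absent, $x_{i,e}\in[0,1]$. (N) the $w_{iv}$ are decision variables; if absent, fixed by $w_{iv}=1$ iff $v=c_i$. (O) minimize $\sum_{v\in V}\sum_{i=1}^p\sum_{e\in E} w_{iv}\, d_{v,e}\, x_{i,e}$; if absent, the objective is $0$. (W) arbitrary positive weights; if absent, $b_e=1$. For $X\subseteq\{B,C,I,N,O,W\}$, $\theta_X$ (also written with the letters listed, e.g. $\theta_{X,N}=\theta_{X\cup\{N\}}$) denotes the problem with group S and exactly the groups in $X$; solving it means outputting an optimal solution (if $O\in X$) or a feasible one (otherwise), or reporting infeasibility. $P_1 \le_P P_2$ means $P_1$ is polynomial-time reducible to $P_2$. *)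

theory Defs
  imports Complex_Main "HOL-Library.Extended_Real"
begin

section \<open>Polynomial time and reductions between search problems\<close>

datatype sym = Zero | One | Sep

datatype dir = MoveL | Stay | MoveR

text \<open>Deterministic multi-tape Turing machines over the alphabet \<^typ>\<open>sym\<close>, with \<^const>\<open>None\<close> as the
  blank. The states are \<open>0, \<dots>, nstates\<close>; \<open>0\<close> is initial and \<open>nstates\<close> is the halting state.
  Only the finitely many values of \<open>delta\<close> at states below \<open>nstates\<close> and at lists of
  length \<open>ntapes\<close> matter, so \<open>delta\<close> is a finite transition table.\<close>

record tm =
  ntapes :: nat
  nstates :: nat
  delta :: "nat \<Rightarrow> sym option list \<Rightarrow> nat \<times> (sym option \<times> dir) list"

definition wf_tm :: "tm \<Rightarrow> bool" where
  "wf_tm M \<longleftrightarrow> (\<forall>q < nstates M. \<forall>ss. length ss = ntapes M \<longrightarrow>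
     fst (delta M q ss) \<le> nstates M \<and> length (snd (delta M q ss)) = ntapes M)"

text \<open>A tape is two-way infinite and comes with its head position; a configuration consists of
  the state and the tapes.\<close>

type_synonym tape = "(int \<Rightarrow> sym option) \<times> int"
type_synonym config = "nat \<times> (nat \<Rightarrow> tape)"

fun move :: "dir \<Rightarrow> int \<Rightarrow> int" where
  "move MoveL h = h - 1"
| "move Stay h = h"
| "move MoveR h = h + 1"

definition act :: "sym option \<times> dir \<Rightarrow> tape \<Rightarrow> tape" where
  "act a t = ((fst t)(snd t := fst a), move (snd a) (snd t))"

definition scanned :: "tm \<Rightarrow> (nat \<Rightarrow> tape) \<Rightarrow> sym option list" where
  "scanned M T = map (\<lambda>j. fst (T j) (snd (T j))) [0..<ntapes M]"

definition step :: "tm \<Rightarrow> config \<Rightarrow> config" where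
  "step M c = (let q = fst c; T = snd c in
     if q < nstates M
     then let r = delta M q (scanned M T)
          in (fst r, \<lambda>j. if j < ntapes M then act (snd r ! j) (T j) else T j)
     else c)"

definition contents :: "sym list \<Rightarrow> int \<Rightarrow> sym option" where
  "contents s = (\<lambda>i. if 0 \<le> i \<and> i < int (length s) then Some (s ! nat i) else None)"

definition init :: "sym list list \<Rightarrow> config" where
  "init xs = (0, \<lambda>j. (if j < length xs then contents (xs ! j) else (\<lambda>_. None), 0))"

text \<open>The arguments are written on the first tapes and the result is read off the last tape.\<close>

definition outputs_within :: "tm \<Rightarrow> sym list list \<Rightarrow> sym list \<Rightarrow> nat \<Rightarrow> bool" where
  "outputs_within M xs y n \<longleftrightarrow> (\<exists>t \<le> n.
     fst ((step M ^^ t) (init xs)) = nstates M \<and>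
     fst (snd ((step M ^^ t) (init xs)) (ntapes M - 1)) = contents y)"

definition polytime :: "nat \<Rightarrow> (sym list list \<Rightarrow> sym list) \<Rightarrow> bool" where
  "polytime a F \<longleftrightarrow> (\<exists>M c d. wf_tm M \<and> a < ntapes M \<and>
     (\<forall>xs. length xs = a \<longrightarrow>
        outputs_within M xs (F xs) (c * sum_list (map length xs) ^ d + c)))"

text \<open>A search problem consists of its set of instances and, for every instance, the set of
  correct answers.\<close>

record search_problem =
  instances :: "sym list set"
  answers :: "sym list \<Rightarrow> sym list set"

text \<open>Polynomial-time many-one reduction of search problems: instances are translated by \<open>F\<close>, and
  \<open>G\<close> turns any correct answer for the translated instance into one for the original instance.\<close>

definition poly_reducible :: "search_problem \<Rightarrow> search_problem \<Rightarrow> bool"  (infix "\<le>\<^sub>P" 50) where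
  "P \<le>\<^sub>P Q \<longleftrightarrow> (\<exists>F G. polytime 1 F \<and> polytime 2 G \<and>
     (\<forall>x \<in> instances P. F [x] \<in> instances Q \<and>
        (\<forall>y \<in> answers Q (F [x]). G [x, y] \<in> answers P x)))"


section \<open>Encoding numbers as strings\<close>

text \<open>Binary notation, least significant bit first.\<close>

fun bin :: "nat \<Rightarrow> sym list" where
  "bin n = (if n = 0 then [] else (if odd n then One else Zero) # bin (n div 2))"

declare bin.simps [simp del]

definition code :: "nat list \<Rightarrow> sym list" where
  "code ns = concat (map (\<lambda>n. bin n @ [Sep]) ns)"

text \<open>Used for nonnegative rationals only.\<close>

definition enc_rat :: "rat \<Rightarrow> nat list" where
  "enc_rat q = [nat (fst (quotient_of q)), nat (snd (quotient_of q))]"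


section \<open>Edge-based districting\<close>

datatype group = GrpB | GrpC | GrpI | GrpN | GrpO | GrpW

datatype bound_form = Additive | Multiplicative

text \<open>An entry \<open>(u, v, r)\<close> of \<open>edge_list\<close> stands for the undirected edge \<open>{u, v}\<close> of weight \<open>r\<close>.
  The parameter \<open>tol\<close> is the \<open>\<tau>\<close> of the balance bounds.\<close>

record districting =
  vertex_list :: "nat list"
  edge_list :: "(nat \<times> nat \<times> rat) list"
  ndist :: nat
  centers :: "nat list"
  tol :: "rat option"

definition verts :: "districting \<Rightarrow> nat set" where
  "verts J = set (vertex_list J)"

definition edge_order :: "districting \<Rightarrow> nat set list" where
  "edge_order J = map (\<lambda>(u, v, r). {u, v}) (edge_list J)"

definition edges :: "districting \<Rightarrow> nat set set" where
  "edges J = set (edge_order J)"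

definition weight :: "districting \<Rightarrow> nat set \<Rightarrow> real" where
  "weight J e = of_rat (the (map_of (map (\<lambda>(u, v, r). ({u, v}, r)) (edge_list J)) e))"

definition valid_instance :: "bound_form \<Rightarrow> group set \<Rightarrow> districting \<Rightarrow> bool" where
  "valid_instance form X J \<longleftrightarrow>
     distinct (vertex_list J) \<and>
     distinct (edge_order J) \<and>
     (\<forall>(u, v, r) \<in> set (edge_list J). u \<in> verts J \<and> v \<in> verts J \<and> u \<noteq> v \<and> r > 0) \<and>
     (GrpW \<notin> X \<longrightarrow> (\<forall>(u, v, r) \<in> set (edge_list J). r = 1)) \<and>
     0 < ndist J \<and> ndist J \<le> card (edges J) \<and>
     (if GrpN \<in> X then centers J = []
      else length (centers J) = ndist J \<and> set (centers J) \<subseteq> verts J) \<and>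
     (if GrpB \<in> X
      then \<exists>t. tol J = Some t \<and>
             (case form of Additive \<Rightarrow> 0 \<le> t | Multiplicative \<Rightarrow> 0 < t \<and> t \<le> 1)
      else tol J = None)"

definition mean_weight :: "districting \<Rightarrow> real" where
  "mean_weight J = (\<Sum>e \<in> edges J. weight J e) / real (ndist J)"

definition lower_bound :: "bound_form \<Rightarrow> districting \<Rightarrow> real" where
  "lower_bound form J = (let t = of_rat (the (tol J)) in
     case form of Additive \<Rightarrow> (1 - t) * mean_weight J
                | Multiplicative \<Rightarrow> t * mean_weight J)"

definition upper_bound :: "bound_form \<Rightarrow> districting \<Rightarrow> real" where
  "upper_bound form J = (let t = of_rat (the (tol J)) in
     case form of Additive \<Rightarrow> (1 + t) * mean_weight J
                | Multiplicative \<Rightarrow> mean_weight J / t)"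

fun walk :: "'v set set \<Rightarrow> 'v list \<Rightarrow> bool" where
  "walk E [] \<longleftrightarrow> False"
| "walk E [v] \<longleftrightarrow> True"
| "walk E (u # v # vs) \<longleftrightarrow> {u, v} \<in> E \<and> walk E (v # vs)"

fun walk_length :: "('v set \<Rightarrow> real) \<Rightarrow> 'v list \<Rightarrow> real" where
  "walk_length b (u # v # vs) = b {u, v} + walk_length b (v # vs)"
| "walk_length b _ = 0"

text \<open>The distance is \<open>\<infinity>\<close> if there is no walk from \<open>u\<close> to \<open>v\<close>.\<close>

definition sp_dist :: "districting \<Rightarrow> nat \<Rightarrow> nat \<Rightarrow> ereal" where
  "sp_dist J u v = (INF vs \<in> {vs. walk (edges J) vs \<and> hd vs = u \<and> last vs = v}.
     ereal (walk_length (weight J) vs))"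

definition edge_dist :: "real \<Rightarrow> districting \<Rightarrow> nat \<Rightarrow> nat set \<Rightarrow> ereal" where
  "edge_dist \<alpha> J v e = Min (sp_dist J v ` e) + ereal (\<alpha> * weight J e)"

definition boundary :: "districting \<Rightarrow> nat set set \<Rightarrow> nat set set" where
  "boundary J D = {e \<in> edges J - D. e \<inter> \<Union>D \<noteq> {}}"

type_synonym assignment = "nat \<Rightarrow> nat set \<Rightarrow> real"
type_synonym selection = "nat \<Rightarrow> nat \<Rightarrow> real"

definition structural :: "districting \<Rightarrow> assignment \<Rightarrow> selection \<Rightarrow> bool" where
  "structural J x w \<longleftrightarrow>
     (\<forall>e \<in> edges J. (\<Sum>i = 1..ndist J. x i e) = 1) \<and>
     (\<forall>i \<in> {1..ndist J}. (\<Sum>v \<in> verts J. w i v) = 1) \<and>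
     (\<forall>i \<in> {1..ndist J}. \<forall>e \<in> edges J. 0 \<le> x i e) \<and>
     (\<forall>i \<in> {1..ndist J}. \<forall>v \<in> verts J. w i v \<in> {0, 1})"

definition balanced :: "bound_form \<Rightarrow> districting \<Rightarrow> assignment \<Rightarrow> bool" where
  "balanced form J x \<longleftrightarrow> (\<forall>i \<in> {1..ndist J}.
     lower_bound form J \<le> (\<Sum>e \<in> edges J. weight J e * x i e) \<and>
     (\<Sum>e \<in> edges J. weight J e * x i e) \<le> upper_bound form J)"

text \<open>For \<open>D = {}\<close> the inequality would read \<open>0 \<ge> 1\<close>, so \<open>D\<close> ranges over nonempty edge sets.\<close>

definition contiguous :: "districting \<Rightarrow> assignment \<Rightarrow> selection \<Rightarrow> bool" where
  "contiguous J x w \<longleftrightarrow> (\<forall>D. D \<subseteq> edges J \<and> D \<noteq> {} \<longrightarrow> (\<forall>i \<in> {1..ndist J}.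
     (\<Sum>e \<in> boundary J D. x i e) + (\<Sum>e \<in> D. 1 - x i e) + (\<Sum>v \<in> \<Union>D. w i v) \<ge> 1))"

definition feasible ::
    "bound_form \<Rightarrow> group set \<Rightarrow> districting \<Rightarrow> assignment \<Rightarrow> selection \<Rightarrow> bool" where
  "feasible form X J x w \<longleftrightarrow>
     structural J x w \<and>
     (GrpB \<in> X \<longrightarrow> balanced form J x) \<and>
     (GrpC \<in> X \<longrightarrow> contiguous J x w) \<and>
     (\<forall>i \<in> {1..ndist J}. \<forall>e \<in> edges J. x i e \<in> (if GrpI \<in> X then {0, 1} else {0..1})) \<and>
     (GrpN \<notin> X \<longrightarrow> (\<forall>i \<in> {1..ndist J}. \<forall>v \<in> verts J.
        w i v = (if v = centers J ! (i - 1) then 1 else 0)))"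

text \<open>In \<^typ>\<open>ereal\<close> we have \<open>0 * \<infinity> = 0\<close>, so unreachable edges only count where they are assigned.\<close>

definition objective :: "real \<Rightarrow> group set \<Rightarrow> districting \<Rightarrow> assignment \<Rightarrow> selection \<Rightarrow> ereal" where
  "objective \<alpha> X J x w =
     (if GrpO \<in> X
      then \<Sum>v \<in> verts J. \<Sum>i = 1..ndist J. \<Sum>e \<in> edges J.
             ereal (w i v) * edge_dist \<alpha> J v e * ereal (x i e)
      else 0)"

definition optimal ::
    "bound_form \<Rightarrow> real \<Rightarrow> group set \<Rightarrow> districting \<Rightarrow> assignment \<Rightarrow> selection \<Rightarrow> bool" where
  "optimal form \<alpha> X J x w \<longleftrightarrow> feasible form X J x w \<and>
     (\<forall>x' w'. feasible form X J x' w' \<longrightarrow> objective \<alpha> X J x w \<le> objective \<alpha> X J x' w')"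

text \<open>The vertices are listed explicitly, so that the length of the encoding is at least
  the number of vertices.\<close>

definition enc_instance :: "districting \<Rightarrow> sym list" where
  "enc_instance J = code
     ([length (vertex_list J), length (edge_list J), ndist J] @ vertex_list J @
      concat (map (\<lambda>(u, v, r). [u, v] @ enc_rat r) (edge_list J)) @
      centers J @
      (case tol J of None \<Rightarrow> [] | Some t \<Rightarrow> enc_rat t))"

definition enc_solution ::
    "districting \<Rightarrow> (nat \<Rightarrow> nat set \<Rightarrow> rat) \<Rightarrow> (nat \<Rightarrow> nat \<Rightarrow> rat) \<Rightarrow> sym list" where
  "enc_solution J x w = code (1 #
     concat (map (\<lambda>i. concat (map (\<lambda>e. enc_rat (x i e)) (edge_order J))) [1..<Suc (ndist J)]) @
     concat (map (\<lambda>i. concat (map (\<lambda>v. enc_rat (w i v)) (vertex_list J))) [1..<Suc (ndist J)]))"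

definition enc_infeasible :: "sym list" where
  "enc_infeasible = code [0]"

text \<open>Answers carry rational values, but optimality and infeasibility refer to all real
  solutions.\<close>

definition theta :: "bound_form \<Rightarrow> real \<Rightarrow> group set \<Rightarrow> search_problem" where
  "theta form \<alpha> X =
     \<lparr> instances = {enc_instance J | J. valid_instance form X J},
       answers = (\<lambda>s. {y. \<exists>J. valid_instance form X J \<and> s = enc_instance J \<and>
         ((\<exists>x w. optimal form \<alpha> X J (\<lambda>i e. of_rat (x i e)) (\<lambda>i v. of_rat (w i v)) \<and>
                 y = enc_solution J x w) \<or>
          (\<not> (\<exists>x w. feasible form X J x w) \<and> y = enc_infeasible))}) \<rparr>"

end

theory Submission
  imports Defs "Jordan_Normal_Form.Determinant"
begin

text \<open>If \<open>B\<close> is already in \<open>X\<close>, the identity is a reduction. Otherwise a tolerance is appended to the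
  instance that is so lax that the balance constraints do not change the optimal value, and answers are
  returned unchanged. In the additive form \<open>\<tau> \<ge> p\<close> suffices. In the multiplicative form the lower bound
  is positive, so it must be shown that every solution is dominated by one in which no district is
  nearly empty; this uses that the centers are free. Integral solutions: an empty district receives an edge whose
  removal keeps its old district contiguous, and the new center is an endpoint of that edge. Fractional
  solutions: for fixed centers pass to a vertex of the feasible polytope, whose nonzero coordinates are at
  least \<open>2\<^sup>-\<^sup>K\<close> with \<open>K\<close> polynomial by Cramer's rule; then let the empty districts share the edges and the
  center of a nonempty one. Hence \<open>\<tau> = 2\<^sup>-\<^sup>K\<close> works with \<open>K\<close> the cube of the input length, and a Turing machine
  writes it by three nested loops over the input.\<close>

section \<open>Two polynomial-time Turing machines\<close>

text \<open>An answer does not mention the tolerance, so returning it unchanged rests on two facts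
  about the lax instance: its feasible solutions are feasible for the old one, and every old
  feasible solution is dominated by a new one. The second also transfers infeasibility and makes the
  optimal values agree exactly. For fixed centers the constraints on \<open>x\<close> have
  coefficients -1, 0, 1, and weights enter only the objective. So the size of a vertex depends on
  \<open>p\<close> and \<open>m = |E|\<close> alone. There are \<open>p m <= m^2\<close> variables,
  and the exponentially many contiguity inequalities contribute a number of bits linear in
  \<open>m\<close> to each of the \<open>p m\<close> factors of the Cramer bound: hence the cube.
  The weights add only a multiple of the input length. Since any larger exponent serves as well, the
  machine need not parse its input: it copies it and emits zeros. Unreachable edges have infinite
  distance. Rounding must therefore not give a district an edge of which it had no share, which is
  why the vertex is chosen so that all tight inequalities of the given solution remain
  tight.\<close>

definition reach :: "tm \<Rightarrow> nat \<Rightarrow> config \<Rightarrow> config \<Rightarrow> bool" where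
  "reach M t c c' \<longleftrightarrow> (step M ^^ t) c = c'"

lemma reach_0: "reach M 0 c c"
  by (simp add: reach_def)

lemma reach_step: "step M c = c' \<Longrightarrow> reach M 1 c c'"
  by (simp add: reach_def)

lemma reach_trans: "reach M s c c' \<Longrightarrow> reach M t c' c'' \<Longrightarrow> reach M (s + t) c c''"
  by (simp add: reach_def add.commute[of s t] funpow_add)

text \<open>Tapes past the list are blank with head at 0, as in \<open>init\<close>, so a run can be
  followed on a list of tapes.\<close>

definition conf :: "nat \<Rightarrow> tape list \<Rightarrow> config" where
  "conf q ts = (q, \<lambda>j. if j < length ts then ts ! j else (\<lambda>_. None, 0))"

lemma step_conf:
  assumes "q < nstates M" "length ts = ntapes M"
    and "delta M q (map (\<lambda>t. fst t (snd t)) ts) = (q', as)" "length as = ntapes M"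
  shows "step M (conf q ts) = conf q' (map2 act as ts)"
proof -
  have "scanned M (snd (conf q ts)) = map (\<lambda>t. fst t (snd t)) ts"
    using assms(2) by (intro nth_equalityI) (auto simp: scanned_def conf_def)
  then show ?thesis
    using assms by (auto simp: step_def conf_def Let_def fun_eq_iff)
qed

lemma act_keep: "act (T h, d) (T, h) = (T, move d h)"
  by (simp add: act_def)

lemma contents_None: "contents s h = None \<longleftrightarrow> h < 0 \<or> h \<ge> int (length s)"
  by (auto simp: contents_def)

lemma contents_append: "(contents s)(int (length s) := Some a) = contents (s @ [a])"
  by (auto simp: contents_def fun_eq_iff nth_append)

lemma contents_nth: "k < length s \<Longrightarrow> contents s (int k) = Some (s ! k)"
  by (auto simp: contents_def)

lemma contents_Nil: "contents [] = (\<lambda>_. None)"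
  by (auto simp: contents_def)

definition written :: "sym list \<Rightarrow> tape" where
  "written s = (contents s, int (length s))"

lemma act_written: "act (Some a, MoveR) (written s) = written (s @ [a])"
  by (simp add: act_def written_def contents_append)

lemma written_Nil: "written [] = (\<lambda>_. None, 0)"
  by (simp add: written_def contents_Nil)

lemma init_conf:
  assumes "length xs \<le> n"
  shows "init xs = conf 0 (map (\<lambda>x. (contents x, 0)) xs @ replicate (n - length xs) (written []))"
  using assms by (auto simp: init_def conf_def fun_eq_iff nth_append written_Nil)

lemma outputs_withinI:
  assumes "reach M t (init xs) (conf (nstates M) ts)" "t \<le> n"
    and "length ts = ntapes M" "ts \<noteq> []" "fst (last ts) = contents y"
  shows "outputs_within M xs y n"
proof -
  have "ntapes M - 1 < length ts"
    using assms(3,4) by (cases ts) auto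
  then show ?thesis
    unfolding outputs_within_def
    using assms by (intro exI[of _ t]) (auto simp: reach_def conf_def last_conv_nth)
qed

section \<open>Projections\<close>

definition copier :: "nat \<Rightarrow> tm" where
  "copier k = \<lparr> ntapes = k + 2, nstates = 1,
     delta = (\<lambda>q ss. if ss ! k = None
       then (1, map (\<lambda>s. (s, Stay)) ss)
       else (0, map (\<lambda>s. (s, Stay)) (take k ss) @ [(ss ! k, MoveR), (ss ! k, MoveR)])) \<rparr>"

lemma map2_act_Stay: "map2 act (map (\<lambda>t. (fst t (snd t), Stay)) ts) ts = ts"
  by (intro nth_equalityI) (auto simp: act_def)

text \<open>The case \<open>k = 0\<close> is the identity on instances; \<open>k = 1\<close> forgets
  the instance and returns the answer.\<close>

lemma polytime_nth: "polytime (Suc k) (\<lambda>xs. xs ! k)"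
proof -
  define M where "M = copier k"
  have nt: "ntapes M = k + 2" and ns: "nstates M = 1"
    by (simp_all add: M_def copier_def)
  have wf: "wf_tm M"
    by (auto simp: wf_tm_def M_def copier_def)
  \<comment> \<open>One step per symbol and one for the blank behind it: a linear bound with
    constants 1.\<close>
  have out: "outputs_within M xs (xs ! k) (1 * sum_list (map length xs) ^ 1 + 1)"
    if len: "length xs = Suc k" for xs
  proof -
    let ?x = "xs ! k"
    define ps where "ps = map (\<lambda>x. (contents x, 0::int)) (take k xs)"
    have lps: "length ps = k" using len by (simp add: ps_def)
    let ?c = "\<lambda>j. conf 0 (ps @ [(contents ?x, int j), written (take j ?x)])"
    have st: "step M (?c j) = ?c (Suc j)" if j: "j < length ?x" for j
    proof -
      let ?t = "ps @ [(contents ?x, int j), written (take j ?x)]"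
      have wr: "snd (written (take j ?x)) = int j"
        using j by (simp add: written_def)
      have rd: "map (\<lambda>t. fst t (snd t)) ?t ! k = Some (?x ! j)"
        using lps j by (simp add: nth_append contents_nth)
      have "delta M 0 (map (\<lambda>t. fst t (snd t)) ?t) =
          (0, map (\<lambda>t. (fst t (snd t), Stay)) ps @ [(Some (?x ! j), MoveR), (Some (?x ! j), MoveR)])"
        using rd lps by (simp add: M_def copier_def o_def)
      from step_conf[OF _ _ this] lps nt ns
      have "step M (conf 0 ?t) = conf 0 (map2 act (map (\<lambda>t. (fst t (snd t), Stay)) ps) ps @
          [act (Some (?x ! j), MoveR) (contents ?x, int j), act (Some (?x ! j), MoveR) (written (take j ?x))])"
        by simp
      moreover have "act (Some (?x ! j), MoveR) (contents ?x, int j) = (contents ?x, int (Suc j))"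
        using act_keep[of "contents ?x" "int j" MoveR] j by (simp add: contents_nth)
      ultimately show ?thesis
        using j by (simp add: map2_act_Stay act_written take_Suc_conv_app_nth)
    qed
    have "j \<le> length ?x \<Longrightarrow> reach M j (?c 0) (?c j)" for j
    proof (induction j)
      case (Suc j)
      then have "reach M j (?c 0) (?c j)" by simp
      from reach_trans[OF this reach_step[OF st]] Suc show ?case by simp
    qed (simp add: reach_0)
    from this[of "length ?x"] have r1: "reach M (length ?x) (?c 0) (?c (length ?x))" by simp
    have r2: "step M (?c (length ?x)) = conf 1 (ps @ [(contents ?x, int (length ?x)), written ?x])"
    proof -
      let ?t = "ps @ [(contents ?x, int (length ?x)), written ?x]"
      have rd: "map (\<lambda>t. fst t (snd t)) ?t ! k = None"
        using lps by (simp add: nth_append contents_None)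
      have "delta M 0 (map (\<lambda>t. fst t (snd t)) ?t) = (1, map (\<lambda>t. (fst t (snd t), Stay)) ?t)"
        using rd lps by (simp add: M_def copier_def o_def)
      from step_conf[OF _ _ this] lps nt ns
      have "step M (conf 0 ?t) = conf 1 (map2 act (map (\<lambda>t. (fst t (snd t), Stay)) ?t) ?t)"
        by simp
      then show ?thesis unfolding map2_act_Stay by simp
    qed
    have "init xs = ?c 0"
    proof -
      have "xs = take k xs @ [?x]"
        using len by (metis lessI order_refl take_Suc_conv_app_nth take_all_iff)
      then have "map (\<lambda>x. (contents x, 0::int)) xs = ps @ [(contents ?x, 0)]"
        unfolding ps_def by (metis (no_types, lifting) list.simps(8,9) map_append)
      then show ?thesis
        using init_conf[of xs "k + 2"] len by simp
    qed
    with reach_trans[OF r1 reach_step[OF r2]]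
    have r: "reach M (length ?x + 1) (init xs)
        (conf (nstates M) (ps @ [(contents ?x, int (length ?x)), written ?x]))"
      by (simp add: ns)
    have "length ?x \<le> sum_list (map length xs)"
      using len by (intro member_le_sum_list) auto
    with r show ?thesis
      by (intro outputs_withinI[OF r]) (auto simp: nt lps written_def)
  qed
  show ?thesis
    unfolding polytime_def
    using wf out nt by (intro exI[of _ M] exI[of _ 1]) auto
qed

text \<open>State \<open>0\<close> copies the input, states \<open>1, \<dots>, p\<close> emit \<open>pre\<close>, and the states from \<open>p + 6\<close> on emit \<open>suf\<close>.
  States \<open>p + 1\<close>, \<open>p + 2\<close>, \<open>p + 4\<close> run three nested loops whose counters are the heads on tapes
  \<open>0\<close>, \<open>1\<close>, \<open>2\<close>, moving left; \<open>p + 3\<close> and \<open>p + 5\<close> rewind tapes \<open>1\<close> and \<open>2\<close>.\<close>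

definition padder :: "sym list \<Rightarrow> sym list \<Rightarrow> tm" where
  "padder pre suf = (let p = length pre in \<lparr> ntapes = 4, nstates = p + 6 + length suf,
     delta = (\<lambda>q ss. let s0 = ss ! 0; s1 = ss ! 1; s2 = ss ! 2; s3 = ss ! 3 in
       if q = 0 then
         if s0 = None then (1, [(s0, MoveL), (s1, MoveL), (s2, MoveL), (s3, Stay)])
         else (0, [(s0, MoveR), (s0, MoveR), (s0, MoveR), (s0, MoveR)])
       else if q \<le> p then
         (q + 1, [(s0, Stay), (s1, Stay), (s2, Stay), (Some (pre ! (q - 1)), MoveR)])
       else if q = p + 1 then
         if s0 = None then (p + 6, [(s0, Stay), (s1, Stay), (s2, Stay), (s3, Stay)])
         else (p + 2, [(s0, MoveL), (s1, Stay), (s2, Stay), (s3, Stay)])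
       else if q = p + 2 then
         if s1 = None then (p + 3, [(s0, Stay), (s1, MoveR), (s2, Stay), (s3, Stay)])
         else (p + 4, [(s0, Stay), (s1, MoveL), (s2, Stay), (s3, Stay)])
       else if q = p + 3 then
         if s1 = None then (p + 1, [(s0, Stay), (s1, MoveL), (s2, Stay), (s3, Stay)])
         else (p + 3, [(s0, Stay), (s1, MoveR), (s2, Stay), (s3, Stay)])
       else if q = p + 4 then
         if s2 = None then (p + 5, [(s0, Stay), (s1, Stay), (s2, MoveR), (s3, Stay)])
         else (p + 4, [(s0, Stay), (s1, Stay), (s2, MoveL), (Some Zero, MoveR)])
       else if q = p + 5 then
         if s2 = None then (p + 2, [(s0, Stay), (s1, Stay), (s2, MoveL), (s3, Stay)])
         else (p + 5, [(s0, Stay), (s1, Stay), (s2, MoveR), (s3, Stay)])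
       else (q + 1, [(s0, Stay), (s1, Stay), (s2, Stay), (Some (suf ! (q - p - 6)), MoveR)])) \<rparr>)"

context
  fixes pre suf x :: "sym list" and M :: tm and n p :: nat
  defines "M \<equiv> padder pre suf" and "n \<equiv> length x" and "p \<equiv> length pre"
begin

definition pconf :: "nat \<Rightarrow> int \<Rightarrow> int \<Rightarrow> int \<Rightarrow> sym list \<Rightarrow> config" where
  "pconf q a b c y = conf q [(contents x, a), (contents x, b), (contents x, c), written y]"

lemma padder_step:
  assumes "q < p + 6 + length suf"
    and "delta M q [contents x a, contents x b, contents x c, None] =
      (q', [(contents x a, d0), (contents x b, d1), (contents x c, d2), (None, Stay)])"
  shows "step M (pconf q a b c y) = pconf q' (move d0 a) (move d1 b) (move d2 c) y"
proof -
  have "fst (written y) (snd (written y)) = None"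
    by (simp add: written_def contents_None)
  moreover have "act (None, Stay) (written y) = written y"
    by (auto simp: act_def written_def contents_def fun_eq_iff)
  ultimately show ?thesis
    unfolding pconf_def
    using assms step_conf[of q M "[(contents x, a), (contents x, b), (contents x, c), written y]" q'
       "[(contents x a, d0), (contents x b, d1), (contents x c, d2), (None, Stay)]"]
    by (simp add: act_keep) (simp add: M_def padder_def p_def Let_def)
qed

lemma padder_emit:
  assumes "q < p + 6 + length suf"
    and "delta M q [contents x a, contents x b, contents x c, None] =
      (q', [(contents x a, d0), (contents x b, d1), (contents x c, d2), (Some s, MoveR)])"
  shows "step M (pconf q a b c y) = pconf q' (move d0 a) (move d1 b) (move d2 c) (y @ [s])"
proof -
  have "fst (written y) (snd (written y)) = None"
    by (simp add: written_def contents_None)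
  then show ?thesis
    unfolding pconf_def
    using assms step_conf[of q M "[(contents x, a), (contents x, b), (contents x, c), written y]" q'
       "[(contents x a, d0), (contents x b, d1), (contents x c, d2), (Some s, MoveR)]"]
    by (simp add: act_keep act_written) (simp add: M_def padder_def p_def Let_def)
qed

lemmas delta_simps = M_def padder_def p_def[symmetric] Let_def contents_None

text \<open>A head at position \<open>k - 1\<close> represents the counter value \<open>k\<close>;
  the blank cell at \<open>-1\<close> is zero.\<close>

lemma inner_loop:
  "k \<le> n \<Longrightarrow> reach M k (pconf (p + 4) a b (int k - 1) y) (pconf (p + 4) a b (-1) (y @ replicate k Zero))"
proof (induction k arbitrary: y)
  case (Suc k)
  have "step M (pconf (p + 4) a b (int (Suc k) - 1) y) = pconf (p + 4) a b (int k - 1) (y @ [Zero])"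
    using Suc.prems n_def by (subst padder_emit) (auto simp: delta_simps)
  from reach_trans[OF reach_step[OF this] Suc.IH] Suc.prems show ?case
    by simp
qed (simp add: reach_0)

text \<open>Here \<open>k\<close> is the distance to the blank cell at position \<open>n\<close>;
  one more step turns back onto the last symbol, which is the counter value
  \<open>n\<close>.\<close>

lemma inner_rewind:
  "k \<le> n \<Longrightarrow> reach M (k + 1) (pconf (p + 5) a b (int n - int k) y) (pconf (p + 2) a b (int n - 1) y)"
proof (induction k)
  case 0
  have "step M (pconf (p + 5) a b (int n) y) = pconf (p + 2) a b (int n - 1) y"
    using n_def by (subst padder_step) (auto simp: delta_simps)
  from reach_step[OF this] show ?case by simp
next
  case (Suc k)
  have "step M (pconf (p + 5) a b (int n - int (Suc k)) y) = pconf (p + 5) a b (int n - int k) y"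
    using Suc.prems n_def by (subst padder_step) (auto simp: delta_simps)
  from reach_trans[OF reach_step[OF this] Suc.IH] Suc.prems show ?case
    by simp
qed

lemma inner:
  "reach M (2 * n + 2) (pconf (p + 4) a b (int n - 1) y) (pconf (p + 2) a b (int n - 1) (y @ replicate n Zero))"
proof -
  \<comment> \<open>The move right from \<open>-1\<close> ends in cell 0, written as
    \<open>int n - int n\<close> to match \<open>inner_rewind\<close>.\<close>
  have "step M (pconf (p + 4) a b (-1) (y @ replicate n Zero)) = pconf (p + 5) a b (int n - int n) (y @ replicate n Zero)"
    by (subst padder_step) (auto simp: delta_simps)
  from reach_trans[OF inner_loop reach_trans[OF reach_step[OF this] inner_rewind]]
  show ?thesis by (simp add: mult_2)
qed

lemma middle_loop:
  "k \<le> n \<Longrightarrow> reach M (k * (2 * n + 3)) (pconf (p + 2) a (int k - 1) (int n - 1) y)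
     (pconf (p + 2) a (-1) (int n - 1) (y @ replicate (k * n) Zero))"
proof (induction k arbitrary: y)
  case (Suc k)
  have "step M (pconf (p + 2) a (int (Suc k) - 1) (int n - 1) y) = pconf (p + 4) a (int k - 1) (int n - 1) y"
    using Suc.prems n_def by (subst padder_step) (auto simp: delta_simps)
  from reach_trans[OF reach_trans[OF reach_step[OF this] inner] Suc.IH] Suc.prems show ?case
    by (simp add: replicate_add algebra_simps eval_nat_numeral)
qed (simp add: reach_0)

lemma middle_rewind:
  "k \<le> n \<Longrightarrow> reach M (k + 1) (pconf (p + 3) a (int n - int k) c y) (pconf (p + 1) a (int n - 1) c y)"
proof (induction k)
  case 0
  have "step M (pconf (p + 3) a (int n) c y) = pconf (p + 1) a (int n - 1) c y"
    using n_def by (subst padder_step) (auto simp: delta_simps)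
  from reach_step[OF this] show ?case by simp
next
  case (Suc k)
  have "step M (pconf (p + 3) a (int n - int (Suc k)) c y) = pconf (p + 3) a (int n - int k) c y"
    using Suc.prems n_def by (subst padder_step) (auto simp: delta_simps)
  from reach_trans[OF reach_step[OF this] Suc.IH] Suc.prems show ?case
    by simp
qed

lemma middle:
  "reach M (n * (2 * n + 3) + n + 2) (pconf (p + 2) a (int n - 1) (int n - 1) y)
     (pconf (p + 1) a (int n - 1) (int n - 1) (y @ replicate (n * n) Zero))"
proof -
  have "step M (pconf (p + 2) a (-1) (int n - 1) (y @ replicate (n * n) Zero))
      = pconf (p + 3) a (int n - int n) (int n - 1) (y @ replicate (n * n) Zero)"
    by (subst padder_step) (auto simp: delta_simps)
  from reach_trans[OF middle_loop reach_trans[OF reach_step[OF this] middle_rewind]]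
  show ?thesis by (simp add: add.assoc)
qed

text \<open>Each round is one step plus \<open>middle\<close>. Tape 0 is traversed only once, so no
  rewind follows.\<close>

lemma outer_loop:
  "k \<le> n \<Longrightarrow> reach M (k * (n * (2 * n + 3) + n + 3)) (pconf (p + 1) (int k - 1) (int n - 1) (int n - 1) y)
     (pconf (p + 1) (-1) (int n - 1) (int n - 1) (y @ replicate (k * n * n) Zero))"
proof (induction k arbitrary: y)
  case (Suc k)
  have "step M (pconf (p + 1) (int (Suc k) - 1) (int n - 1) (int n - 1) y)
      = pconf (p + 2) (int k - 1) (int n - 1) (int n - 1) y"
    using Suc.prems n_def by (subst padder_step) (auto simp: delta_simps)
  from reach_trans[OF reach_trans[OF reach_step[OF this] middle] Suc.IH] Suc.prems show ?case
    by (simp add: replicate_add algebra_simps eval_nat_numeral)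
qed (simp add: reach_0)

lemma emit_pre:
  "k \<le> p \<Longrightarrow> reach M k (pconf 1 a b c y) (pconf (k + 1) a b c (y @ take k pre))"
proof (induction k)
  case (Suc k)
  have "step M (pconf (k + 1) a b c (y @ take k pre)) = pconf (Suc k + 1) a b c ((y @ take k pre) @ [pre ! k])"
    using Suc.prems by (subst padder_emit) (auto simp: delta_simps)
  with reach_trans[OF Suc.IH reach_step] Suc.prems show ?case
    by (simp add: take_Suc_conv_app_nth p_def)
qed (simp add: reach_0)

lemma emit_suf:
  "k \<le> length suf \<Longrightarrow> reach M k (pconf (p + 6) a b c y) (pconf (p + 6 + k) a b c (y @ take k suf))"
proof (induction k)
  case (Suc k)
  have "step M (pconf (p + 6 + k) a b c (y @ take k suf))
      = pconf (p + 6 + Suc k) a b c ((y @ take k suf) @ [suf ! k])"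
    using Suc.prems by (subst padder_emit) (auto simp: delta_simps)
  with reach_trans[OF Suc.IH reach_step] Suc.prems show ?case
    by (simp add: take_Suc_conv_app_nth p_def)
qed (simp add: reach_0)

text \<open>Tapes 1 and 2 receive the input only to carry its length as a counter range, tape 3
  because the output starts with the input.\<close>

lemma copy_loop:
  "k \<le> n \<Longrightarrow> reach M k (init [x])
     (conf 0 [(contents x, int k), written (take k x), written (take k x), written (take k x)])"
proof (induction k)
  case 0
  have "init [x] = conf 0 [(contents x, 0), written [], written [], written []]"
    using init_conf[of "[x]" 4] by (simp add: eval_nat_numeral)
  then show ?case using reach_0 by simp
next
  case (Suc k)
  let ?t = "[(contents x, int k), written (take k x), written (take k x), written (take k x)]"
  have "step M (conf 0 ?t) = conf 0 (map2 act (replicate 4 (Some (x ! k), MoveR)) ?t)"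
    using Suc.prems n_def by (intro step_conf) (simp_all add: delta_simps contents_nth eval_nat_numeral)
  moreover have "act (Some (x ! k), MoveR) (contents x, int k) = (contents x, int (Suc k))"
    using act_keep[of "contents x" "int k" MoveR] Suc.prems n_def by (simp add: contents_nth)
  ultimately have "step M (conf 0 ?t) = conf 0 [(contents x, int (Suc k)), written (take (Suc k) x),
      written (take (Suc k) x), written (take (Suc k) x)]"
    using Suc.prems n_def by (simp add: act_written take_Suc_conv_app_nth eval_nat_numeral)
  with reach_trans[OF Suc.IH reach_step] Suc.prems show ?case by simp
qed

lemma copy: "reach M (n + 1) (init [x]) (pconf 1 (int n - 1) (int n - 1) (int n - 1) x)"
proof -
  have "step M (pconf 0 (int n) (int n) (int n) x) = pconf 1 (int n - 1) (int n - 1) (int n - 1) x"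
    using n_def by (subst padder_step) (auto simp: delta_simps)
  with reach_trans[OF copy_loop[of n] reach_step] show ?thesis
    by (simp add: pconf_def written_def n_def)
qed

lemma padder_run:
  "reach M (n + 1 + p + (n * (n * (2 * n + 3) + n + 3) + 1 + length suf)) (init [x])
     (pconf (p + 6 + length suf) (-1) (int n - 1) (int n - 1) (x @ pre @ replicate (n ^ 3) Zero @ suf))"
proof -
  have "step M (pconf (p + 1) (-1) (int n - 1) (int n - 1) y) = pconf (p + 6) (-1) (int n - 1) (int n - 1) y" for y
    by (subst padder_step) (auto simp: delta_simps)
  from reach_trans[OF reach_trans[OF copy emit_pre[OF le_refl]]
      reach_trans[OF reach_trans[OF outer_loop[OF le_refl] reach_step[OF this]] emit_suf[OF le_refl]]]
  show ?thesis
    by (simp add: power3_eq_cube p_def mult.assoc)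
qed

end

lemma wf_padder: "wf_tm (padder pre suf)"
  unfolding wf_tm_def padder_def Let_def by simp

lemma polytime_pad:
  "polytime 1 (\<lambda>xs. xs ! 0 @ pre @ replicate (length (xs ! 0) ^ 3) Zero @ suf)"
proof -
  define M where "M = padder pre suf"
  define C where "C = 20 + length pre + length suf"
  have M: "ntapes M = 4" "nstates M = length pre + 6 + length suf"
    by (simp_all add: M_def padder_def Let_def)
  have out: "outputs_within M xs (xs ! 0 @ pre @ replicate (length (xs ! 0) ^ 3) Zero @ suf)
      (C * sum_list (map length xs) ^ 3 + C)" if len: "length xs = 1" for xs
  proof -
    obtain x where xs: "xs = [x]"
      using len by (cases xs) auto
    define n where "n = length x"
    have le: "n \<le> n ^ 3" "n * n \<le> n ^ 3"
      using power_increasing[of 1 3 n] power_increasing[of 2 3 n]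
      by (cases "n = 0"; simp add: power2_eq_square)+
    \<comment> \<open>With \<open>n\<close> and \<open>n * n\<close> bounded by
      \<open>n ^ 3\<close>, the coefficients 2, 4, 3 and the \<open>n\<close> copying steps add up
      to the 10 used next.\<close>
    have "n * (n * (2 * n + 3) + n + 3) = 2 * n ^ 3 + 4 * (n * n) + 3 * n"
      by (simp add: power3_eq_cube algebra_simps)
    with le have "n + 1 + length pre + (n * (n * (2 * n + 3) + n + 3) + 1 + length suf)
        \<le> 10 * n ^ 3 + C"
      unfolding C_def by linarith
    also have "\<dots> \<le> C * n ^ 3 + C"
      by (simp add: C_def)
    finally have time: "n + 1 + length pre + (n * (n * (2 * n + 3) + n + 3) + 1 + length suf)
        \<le> C * n ^ 3 + C" .
    have "outputs_within M [x] (x @ pre @ replicate (n ^ 3) Zero @ suf) (C * n ^ 3 + C)"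
    proof (rule outputs_withinI[OF _ time])
      show "reach M (n + 1 + length pre + (n * (n * (2 * n + 3) + n + 3) + 1 + length suf)) (init [x])
          (conf (nstates M) [(contents x, -1), (contents x, int n - 1), (contents x, int n - 1),
             written (x @ pre @ replicate (n ^ 3) Zero @ suf)])"
        using padder_run[of pre suf x] unfolding pconf_def M(2) unfolding n_def M_def .
    qed (simp_all add: M written_def)
    then show ?thesis
      by (simp add: xs n_def)
  qed
  have "\<forall>xs. length xs = 1 \<longrightarrow> outputs_within M xs
      (xs ! 0 @ pre @ replicate (length (xs ! 0) ^ 3) Zero @ suf) (C * sum_list (map length xs) ^ 3 + C)"
    using out by blast
  moreover have "wf_tm M" "1 < ntapes M"
    by (simp_all add: wf_padder M) (simp add: M_def wf_padder)
  ultimately show ?thesis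
    unfolding polytime_def by blast
qed

section \<open>Rounding solutions of integral linear systems\<close>

definition lin :: "'v set \<Rightarrow> ('v \<Rightarrow> real) \<Rightarrow> ('v \<Rightarrow> real) \<Rightarrow> real" where
  "lin I a y = (\<Sum>v\<in>I. a v * y v)"

definition sat :: "'v set \<Rightarrow> (('v \<Rightarrow> real) \<times> real) set \<Rightarrow> ('v \<Rightarrow> real) \<Rightarrow> bool" where
  "sat I R y \<longleftrightarrow> (\<forall>r\<in>R. snd r \<le> lin I (fst r) y)"

section \<open>Active inequalities and vertices of polytopes\<close>

definition tight :: "'v set \<Rightarrow> (('v \<Rightarrow> real) \<times> real) set \<Rightarrow> ('v \<Rightarrow> real) \<Rightarrow> (('v \<Rightarrow> real) \<times> real) set" where
  "tight I R y = {r \<in> R. lin I (fst r) y = snd r}"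

lemma lin_add_scale: "lin I a (\<lambda>v. y v + t * d v) = lin I a y + t * lin I a d"
  by (simp add: lin_def algebra_simps sum.distrib sum_distrib_left)

lemma lin_uminus: "lin I a (\<lambda>v. - d v) = - lin I a d"
  by (simp add: lin_def sum_negf)

text \<open>Moving from \<open>y\<close> along \<open>d\<close> keeps the tight rows tight and does
  not raise the cost. Boundedness forces some other row to fail eventually; stopping at the first
  such row makes it tight.\<close>

lemma improve_tight:
  assumes fin: "finite R" and bounded: "\<forall>y. sat I R y \<longrightarrow> (\<forall>v\<in>I. \<bar>y v\<bar> \<le> 1)"
    and sat: "sat I R y" and d: "\<And>r. r \<in> tight I R y \<Longrightarrow> lin I (fst r) d = 0"
    and v: "v \<in> I" "d v \<noteq> 0" and c: "lin I c d \<le> 0"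
  obtains y' where "sat I R y'" "lin I c y' \<le> lin I c y" "tight I R y \<subset> tight I R y'"
proof -
  define S where "S = {r \<in> R. lin I (fst r) d < 0}"
  \<comment> \<open>The step length at which a row of \<open>S\<close> becomes tight; its minimum is
    the ratio test of the simplex method.\<close>
  define \<rho> where "\<rho> r = (lin I (fst r) y - snd r) / (- lin I (fst r) d)" for r
  have "S \<noteq> {}"
  proof
    assume "S = {}"
    then have "sat I R (\<lambda>u. y u + t * d u)" if "t \<ge> 0" for t
      using that sat unfolding sat_def lin_add_scale S_def
      by (auto intro!: add_increasing2 mult_nonneg_nonneg simp: not_less)
    then have bd: "\<bar>y v + t * d v\<bar> \<le> 1" if "t \<ge> 0" for t
      using bounded v(1) that by blast
    have "\<bar>y v\<bar> \<le> 1" using bd[of 0] by simp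
    \<comment> \<open>A step of length \<open>3 / |d v|\<close> shifts coordinate \<open>v\<close>
      by 3, so it cannot stay within [-1, 1].\<close>
    moreover have "\<bar>(3 / \<bar>d v\<bar>) * d v\<bar> = 3" using v(2) by (simp add: abs_mult)
    ultimately show False using bd[of "3 / \<bar>d v\<bar>"] v(2) by simp
  qed
  moreover have "finite S" using fin by (simp add: S_def)
  ultimately obtain r0 where r0: "r0 \<in> S" "\<And>r. r \<in> S \<Longrightarrow> \<rho> r0 \<le> \<rho> r"
    using ex_min_if_finite[of "\<rho> ` S"]
    by (metis (mono_tags, lifting) arg_min_if_finite(1) arg_min_least)
  define t where "t = \<rho> r0"
  have t: "t \<ge> 0"
    using r0(1) sat unfolding t_def \<rho>_def S_def sat_def by (intro divide_nonneg_nonneg) auto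
  define y' where "y' = (\<lambda>u. y u + t * d u)"
  have lin': "lin I a y' = lin I a y + t * lin I a d" for a
    by (simp add: y'_def lin_add_scale)
  have "snd r \<le> lin I (fst r) y'" if "r \<in> R" for r
  proof (cases "r \<in> S")
    case True
    then have "t \<le> \<rho> r" "lin I (fst r) d < 0"
      using r0 by (auto simp: t_def S_def)
    then show ?thesis unfolding lin' \<rho>_def by (simp add: field_simps)
  next
    case False
    then have "lin I (fst r) d \<ge> 0" using that by (simp add: S_def)
    then show ?thesis
      using sat that t unfolding lin' sat_def by (intro add_increasing2) auto
  qed
  then have "sat I R y'" by (simp add: sat_def)
  moreover have "lin I c y' \<le> lin I c y"
    using t c by (simp add: lin' mult_nonneg_nonpos)
  moreover have "tight I R y \<subseteq> tight I R y'"
    using d by (auto simp: tight_def lin')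
  moreover have "r0 \<in> tight I R y' - tight I R y"
    using r0(1) d[of r0] by (auto simp: tight_def lin' t_def \<rho>_def S_def field_simps)
  ultimately show ?thesis using that by blast
qed

text \<open>Among the points that cost no more than \<open>x\<close> and keep its tight rows, take
  one with the most tight rows: a nonzero direction in their common kernel would allow
  \<open>improve_tight\<close> to gain another. Keeping the tight rows of \<open>x\<close> later
  means that zero coordinates stay zero.\<close>

lemma vertex_dominates:
  assumes fin: "finite R" and bounded: "\<forall>y. sat I R y \<longrightarrow> (\<forall>v\<in>I. \<bar>y v\<bar> \<le> 1)"
    and x: "sat I R x"
  obtains y where "sat I R y" "lin I c y \<le> lin I c x" "tight I R x \<subseteq> tight I R y"
    and "\<And>d. (\<And>r. r \<in> tight I R y \<Longrightarrow> lin I (fst r) d = 0) \<Longrightarrow> \<forall>v\<in>I. d v = 0"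
proof -
  define P where "P y \<longleftrightarrow> sat I R y \<and> lin I c y \<le> lin I c x \<and> tight I R x \<subseteq> tight I R y" for y
  have ft: "finite (tight I R y)" for y using fin by (simp add: tight_def)
  have "P x" using x by (simp add: P_def)
  moreover have "card (tight I R y) < Suc (card R)" for y
    using fin by (simp add: tight_def card_mono less_Suc_eq_le)
  ultimately obtain y where y: "P y" "\<And>z. P z \<Longrightarrow> card (tight I R z) \<le> card (tight I R y)"
    using ex_has_greatest_nat[of P x "\<lambda>y. card (tight I R y)" "Suc (card R)"] by (metis less_imp_le)
  have "d v = 0" if d: "\<And>r. r \<in> tight I R y \<Longrightarrow> lin I (fst r) d = 0" and v: "v \<in> I" for d v
  proof (rule ccontr)
    assume nz: "d v \<noteq> 0"
    \<comment> \<open>Both \<open>d\<close> and its negative lie in the kernel; one of them does not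
      increase the cost.\<close>
    define e where "e = (if lin I c d \<le> 0 then d else (\<lambda>u. - d u))"
    have "lin I (fst r) e = 0" if "r \<in> tight I R y" for r
      using d[OF that] by (simp add: e_def lin_uminus)
    moreover have "e v \<noteq> 0" "lin I c e \<le> 0"
      using nz by (auto simp: e_def lin_uminus)
    ultimately obtain y' where "sat I R y'" "lin I c y' \<le> lin I c y" "tight I R y \<subset> tight I R y'"
      using improve_tight[OF fin bounded, of y e v c] y(1) v unfolding P_def by blast
    moreover from this y(1) have "P y'" unfolding P_def by force
    ultimately show False
      using y(2)[of y'] psubset_card_mono[OF ft[of y']] by (meson not_le)
  qed
  with y(1) that show ?thesis unfolding P_def by blast
qed

section \<open>Cramer's rule for integral systems\<close>

lemma det_Ints:
  fixes A :: "real mat"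
  assumes "A \<in> carrier_mat n n" "\<And>i j. i < n \<Longrightarrow> j < n \<Longrightarrow> A $$ (i, j) \<in> \<int>"
  shows "det A \<in> \<int>"
  unfolding det_def'[OF assms(1)]
proof (intro Ints_sum Ints_mult Ints_prod)
  fix p i assume "p \<in> {p. p permutes {0..<n}}" "i \<in> {0..<n}"
  then have "i < n" "p i < n" using permutes_in_image[of p "{0..<n}" i] by auto
  then show "A $$ (i, p i) \<in> \<int>" using assms by blast
qed (auto simp: sign_def)

text \<open>The Leibniz expansion has \<open>n!\<close> signed products of \<open>n\<close> entries
  each. Both factors reappear in \<open>vertex_bound\<close>.\<close>

lemma det_abs_le:
  fixes A :: "real mat"
  assumes A: "A \<in> carrier_mat n n" and B: "\<And>i j. i < n \<Longrightarrow> j < n \<Longrightarrow> \<bar>A $$ (i, j)\<bar> \<le> B"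
  shows "\<bar>det A\<bar> \<le> fact n * B ^ n"
proof -
  have "\<bar>det A\<bar> \<le> (\<Sum>p\<in>{p. p permutes {0..<n}}. \<bar>signof p * (\<Prod>i = 0..<n. A $$ (i, p i))\<bar>)"
    unfolding det_def'[OF A] by (rule sum_abs)
  also have "\<dots> \<le> (\<Sum>p\<in>{p. p permutes {0..<n}}. B ^ n)"
  proof (rule sum_mono)
    fix p assume p: "p \<in> {p. p permutes {0..<n}}"
    have "\<bar>signof p * (\<Prod>i = 0..<n. A $$ (i, p i))\<bar> = (\<Prod>i = 0..<n. \<bar>A $$ (i, p i)\<bar>)"
      by (simp add: abs_mult abs_prod sign_def)
    also have "\<dots> \<le> (\<Prod>i = 0..<n. B)"
    proof (rule prod_mono)
      fix i assume "i \<in> {0..<n}"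
      then have "i < n" "p i < n" using p permutes_in_image[of p "{0..<n}" i] by auto
      then show "0 \<le> \<bar>A $$ (i, p i)\<bar> \<and> \<bar>A $$ (i, p i)\<bar> \<le> B" using B by auto
    qed
    finally show "\<bar>signof p * (\<Prod>i = 0..<n. A $$ (i, p i))\<bar> \<le> B ^ n" by simp
  qed
  also have "\<dots> = fact n * B ^ n"
    by (simp add: card_permutations[of _ n])
  finally show ?thesis .
qed

text \<open>Passing to the normal equations \<open>A\<^sup>T A y = A\<^sup>T b\<close> gives a nonsingular square integer system
  without having to select independent rows.\<close>

lemma unique_solution_lower_bound:
  assumes fin: "finite T" "finite I"
    and int: "\<And>r v. r \<in> T \<Longrightarrow> v \<in> I \<Longrightarrow> fst r v \<in> \<int> \<and> \<bar>fst r v\<bar> \<le> 1" "\<And>r. r \<in> T \<Longrightarrow> snd r \<in> \<int>"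
    and sol: "\<And>r. r \<in> T \<Longrightarrow> lin I (fst r) y = snd r"
    and uniq: "\<And>d. (\<And>r. r \<in> T \<Longrightarrow> lin I (fst r) d = 0) \<Longrightarrow> \<forall>v\<in>I. d v = 0"
    and v: "v \<in> I" "y v \<noteq> 0"
  shows "1 \<le> fact (card I) * real (card T) ^ card I * \<bar>y v\<bar>"
proof -
  define n where "n = card I"
  obtain h where h: "bij_betw h {0..<n} I"
    using ex_bij_betw_nat_finite[OF fin(2)] unfolding n_def by blast
  have hI: "h i \<in> I" if "i < n" for i
    using h that by (auto simp: bij_betw_def)
  have reindex: "lin I a z = (\<Sum>i = 0..<n. a (h i) * z (h i))" for a z :: "'a \<Rightarrow> real"
    unfolding lin_def using sum.reindex_bij_betw[OF h, of "\<lambda>v. a v * z v"] by simp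
  \<comment> \<open>This is \<open>A^T A\<close>, where the members of \<open>T\<close> are the rows
    of \<open>A\<close> and \<open>h\<close> numbers its columns.\<close>
  define N where "N = mat n n (\<lambda>(i, j). \<Sum>r\<in>T. fst r (h i) * fst r (h j))"
  have N: "N \<in> carrier_mat n n" by (simp add: N_def)
  have Nz: "(N *\<^sub>v vec n (\<lambda>j. z (h j))) $ i = (\<Sum>r\<in>T. fst r (h i) * lin I (fst r) z)"
    if "i < n" for i and z :: "'a \<Rightarrow> real"
  proof -
    have "(N *\<^sub>v vec n (\<lambda>j. z (h j))) $ i = (\<Sum>j = 0..<n. (\<Sum>r\<in>T. fst r (h i) * fst r (h j)) * z (h j))"
      using that by (simp add: N_def scalar_prod_def)
    also have "\<dots> = (\<Sum>j = 0..<n. \<Sum>r\<in>T. fst r (h i) * (fst r (h j) * z (h j)))"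
      by (simp add: sum_distrib_right mult.assoc)
    also have "\<dots> = (\<Sum>r\<in>T. fst r (h i) * lin I (fst r) z)"
      by (subst sum.swap) (simp add: reindex sum_distrib_left)
    finally show ?thesis .
  qed
  have "det N \<noteq> 0"
  proof
    assume "det N = 0"
    then obtain w where w: "w \<in> carrier_vec n" "w \<noteq> 0\<^sub>v n" "N *\<^sub>v w = 0\<^sub>v n"
      using det_0_iff_vec_prod_zero_field[OF N] by blast
    define d where "d u = w $ (inv_into {0..<n} h u)" for u
    have dh: "d (h i) = w $ i" if "i < n" for i
      using h that by (simp add: d_def bij_betw_def inv_into_f_f)
    have "vec n (\<lambda>j. d (h j)) = w" using w(1) by (intro eq_vecI) (auto simp: dh)
    then have z: "(\<Sum>r\<in>T. fst r (h i) * lin I (fst r) d) = 0" if "i < n" for i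
      using Nz[OF that, of d] w(3) that by simp
    \<comment> \<open>This is \<open>|A d|^2 = d^T (N d)\<close>: a kernel vector of
      \<open>N\<close> is one of \<open>A\<close>, to which \<open>uniq\<close> applies.\<close>
    have "(\<Sum>r\<in>T. (lin I (fst r) d)\<^sup>2) = (\<Sum>r\<in>T. \<Sum>i = 0..<n. d (h i) * (fst r (h i) * lin I (fst r) d))"
      by (simp add: power2_eq_square reindex[of _ d] sum_distrib_right sum_distrib_left mult_ac)
    also have "\<dots> = (\<Sum>i = 0..<n. d (h i) * (\<Sum>r\<in>T. fst r (h i) * lin I (fst r) d))"
      by (subst sum.swap) (simp add: sum_distrib_left)
    also have "\<dots> = 0" using z by simp
    finally have "\<And>r. r \<in> T \<Longrightarrow> lin I (fst r) d = 0"
      using fin(1) by (subst (asm) sum_nonneg_eq_0_iff) auto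
    then have "\<forall>v\<in>I. d v = 0" by (rule uniq)
    then have "w = 0\<^sub>v n" using w(1) dh hI by (intro eq_vecI) force+
    with w(2) show False by blast
  qed
  obtain k where k: "k < n" "v = h k"
    using h v(1) by (auto simp: bij_betw_def)
  define yv where "yv = vec n (\<lambda>j. y (h j))"
  have Ny: "(N *\<^sub>v yv) $ i \<in> \<int>" if "i < n" for i
    unfolding yv_def Nz[OF that] using sol int hI[OF that] by (auto intro!: Ints_sum Ints_mult)
  have NInt: "N $$ (i, j) \<in> \<int>" if "i < n" "j < n" for i j
    using that int hI by (auto simp: N_def intro!: Ints_sum Ints_mult)
  \<comment> \<open>By Cramer's rule this is the determinant of an integer matrix. Being nonzero, it
    is at least 1 in absolute value, so \<open>|y v| >= 1 / |det N|\<close>.\<close>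
  have "y v * det N = det (replace_col N (N *\<^sub>v yv) k)"
    using cramer_lemma_mat[OF N _ k(1), of yv] k by (simp add: yv_def)
  also have "\<dots> \<in> \<int>"
    by (rule det_Ints[of _ n]) (use N Ny NInt in \<open>auto simp: replace_col_def\<close>)
  finally have "y v * det N \<in> \<int>" .
  then have "1 \<le> \<bar>y v * det N\<bar>"
    using v(2) \<open>det N \<noteq> 0\<close> by (intro Ints_nonzero_abs_ge1) auto
  also have "\<dots> = \<bar>det N\<bar> * \<bar>y v\<bar>" by (simp add: abs_mult mult.commute)
  \<comment> \<open>Each entry of \<open>N\<close> sums \<open>card T\<close> products of absolute
    value at most 1.\<close>
  also have "\<bar>det N\<bar> \<le> fact n * real (card T) ^ n"
  proof (rule det_abs_le[OF N])
    fix i j assume ij: "i < n" "j < n"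
    have "\<bar>N $$ (i, j)\<bar> \<le> (\<Sum>r\<in>T. \<bar>fst r (h i) * fst r (h j)\<bar>)"
      using ij by (simp add: N_def sum_abs)
    also have "\<dots> \<le> (\<Sum>r\<in>T. 1)"
      using int(1) hI ij by (intro sum_mono) (auto simp: abs_mult intro!: mult_le_one)
    finally show "\<bar>N $$ (i, j)\<bar> \<le> real (card T)" by simp
  qed
  finally show ?thesis by (simp add: n_def mult_right_mono)
qed

text \<open>Which rows are tight at the vertex is unknown, so their number is replaced by any bound
  \<open>M\<close> on the number of all rows.\<close>

lemma vertex_round:
  assumes fin: "finite R" "finite I" and bounded: "\<forall>y. sat I R y \<longrightarrow> (\<forall>v\<in>I. \<bar>y v\<bar> \<le> 1)"
    and x: "sat I R x" and M: "card R \<le> M"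
    and int: "\<And>r v. r \<in> R \<Longrightarrow> v \<in> I \<Longrightarrow> fst r v \<in> \<int> \<and> \<bar>fst r v\<bar> \<le> 1" "\<And>r. r \<in> R \<Longrightarrow> snd r \<in> \<int>"
  obtains y where "sat I R y" "lin I c y \<le> lin I c x" "tight I R x \<subseteq> tight I R y"
    and "\<And>v. v \<in> I \<Longrightarrow> y v \<noteq> 0 \<Longrightarrow> 1 \<le> fact (card I) * real M ^ card I * \<bar>y v\<bar>"
proof -
  obtain y where y: "sat I R y" "lin I c y \<le> lin I c x" "tight I R x \<subseteq> tight I R y"
    and uniq: "\<And>d. (\<And>r. r \<in> tight I R y \<Longrightarrow> lin I (fst r) d = 0) \<Longrightarrow> \<forall>v\<in>I. d v = 0"
    using vertex_dominates[OF fin(1) bounded x] by blast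
  have "1 \<le> fact (card I) * real M ^ card I * \<bar>y v\<bar>" if "v \<in> I" "y v \<noteq> 0" for v
  proof -
    have "1 \<le> fact (card I) * real (card (tight I R y)) ^ card I * \<bar>y v\<bar>"
      using that fin int uniq
      by (intro unique_solution_lower_bound) (auto simp: tight_def)
    also have "\<dots> \<le> fact (card I) * real M ^ card I * \<bar>y v\<bar>"
      using M card_mono[of R "tight I R y"] fin(1)
      by (intro mult_right_mono mult_left_mono power_mono) (auto simp: tight_def)
    finally show ?thesis .
  qed
  with y that show ?thesis by blast
qed

section \<open>Costs and contiguity\<close>

lemma finite_edges: "finite (edges J)"
  by (simp add: edges_def)

lemma edgeE:
  assumes "valid_instance form X J" "e \<in> edges J"
  obtains u v r where "(u, v, r) \<in> set (edge_list J)" "e = {u, v}" "u \<in> verts J" "v \<in> verts J"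
    "u \<noteq> v" "r > 0" "weight J e = of_rat r"
proof -
  from assms(2) obtain u v r where m: "(u, v, r) \<in> set (edge_list J)" "e = {u, v}"
    by (auto simp: edges_def edge_order_def)
  let ?al = "map (\<lambda>(u, v, r). ({u, v}, r)) (edge_list J)"
  have "map fst ?al = edge_order J"
    by (auto simp: edge_order_def)
  then have "distinct (map fst ?al)"
    using assms(1) by (simp add: valid_instance_def)
  moreover have "(e, r) \<in> set ?al"
    using m by force
  ultimately have "map_of ?al e = Some r"
    by (rule map_of_is_SomeI)
  then have "weight J e = of_rat r"
    by (simp add: weight_def)
  moreover have "u \<in> verts J \<and> v \<in> verts J \<and> u \<noteq> v \<and> r > 0"
    using m(1) assms(1) unfolding valid_instance_def by blast
  ultimately show ?thesis using m that by blast
qed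

lemma weight_pos:
  assumes "valid_instance form X J" "e \<in> edges J"
  shows "weight J e > 0"
  using edgeE[OF assms] by (metis zero_less_of_rat_iff)

lemma edge_subset_verts:
  assumes "valid_instance form X J" "e \<in> edges J"
  shows "e \<subseteq> verts J" "finite e" "e \<noteq> {}"
  using edgeE[OF assms] by blast+

lemma finite_verts: "finite (verts J)"
  by (simp add: verts_def)

lemma walk_length_nonneg:
  "(\<And>e. e \<in> E \<Longrightarrow> 0 \<le> b e) \<Longrightarrow> walk E vs \<Longrightarrow> 0 \<le> walk_length b vs"
  by (induction E vs rule: walk.induct) auto

lemma sp_dist_nonneg:
  assumes "valid_instance form X J"
  shows "0 \<le> sp_dist J u v"
  unfolding sp_dist_def
  using walk_length_nonneg[of "edges J" "weight J"] weight_pos[OF assms]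
  by (intro INF_greatest) (auto simp: less_imp_le)

lemma sp_dist_self:
  assumes "valid_instance form X J"
  shows "sp_dist J u u = 0"
proof (rule antisym)
  show "sp_dist J u u \<le> 0"
    unfolding sp_dist_def by (rule INF_lower2[of "[u]"]) auto
qed (rule sp_dist_nonneg[OF assms])

lemma edge_dist_ge:
  assumes "valid_instance form X J" "e \<in> edges J"
  shows "ereal (\<alpha> * weight J e) \<le> edge_dist \<alpha> J v e"
proof -
  have "0 \<le> Min (sp_dist J v ` e)"
    using edge_subset_verts[OF assms] sp_dist_nonneg[OF assms(1)] by simp
  then show ?thesis
    unfolding edge_dist_def using add_mono[of 0 _ "ereal (\<alpha> * weight J e)"] by force
qed

lemma edge_dist_endpoint:
  assumes "valid_instance form X J" "e \<in> edges J" "v \<in> e"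
  shows "edge_dist \<alpha> J v e = ereal (\<alpha> * weight J e)"
proof -
  have "Min (sp_dist J v ` e) = 0"
    using edge_subset_verts[OF assms(1,2)] sp_dist_nonneg[OF assms(1)] sp_dist_self[OF assms(1), of v] assms(3)
    by (intro Min_eqI) (auto simp: image_iff intro!: bexI[of _ v])
  then show ?thesis by (simp add: edge_dist_def)
qed

text \<open>For nonnegative entries, the objective (if present) is finite exactly in this case.
  Isolating it lets all cost comparisons take place in real arithmetic.\<close>

definition finite_cost :: "real \<Rightarrow> districting \<Rightarrow> assignment \<Rightarrow> selection \<Rightarrow> bool" where
  "finite_cost \<alpha> J x w \<longleftrightarrow> (\<forall>i\<in>{1..ndist J}. \<forall>v\<in>verts J. \<forall>e\<in>edges J.
     w i v \<noteq> 0 \<longrightarrow> x i e \<noteq> 0 \<longrightarrow> edge_dist \<alpha> J v e \<noteq> \<infinity>)"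

text \<open>The distance from the center of \<open>i\<close> to \<open>e\<close>. An infinite
  distance becomes 0 under \<open>real_of_ereal\<close>; under \<open>finite_cost\<close> such a
  term is multiplied by a vanishing \<open>w i v\<close> or \<open>x i e\<close>.\<close>

definition unit_cost :: "real \<Rightarrow> districting \<Rightarrow> selection \<Rightarrow> nat \<Rightarrow> nat set \<Rightarrow> real" where
  "unit_cost \<alpha> J w i e = (\<Sum>v\<in>verts J. w i v * real_of_ereal (edge_dist \<alpha> J v e))"

definition real_cost :: "real \<Rightarrow> districting \<Rightarrow> assignment \<Rightarrow> selection \<Rightarrow> real" where
  "real_cost \<alpha> J x w = (\<Sum>e\<in>edges J. \<Sum>i = 1..ndist J. unit_cost \<alpha> J w i e * x i e)"

lemma objective_finite:
  assumes "valid_instance form X J" "GrpO \<in> Y" "finite_cost \<alpha> J x w"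
  shows "objective \<alpha> Y J x w = ereal (real_cost \<alpha> J x w)"
proof -
  have t: "ereal (w i v) * edge_dist \<alpha> J v e * ereal (x i e)
      = ereal (w i v * real_of_ereal (edge_dist \<alpha> J v e) * x i e)"
    if "i \<in> {1..ndist J}" "v \<in> verts J" "e \<in> edges J" for i v e
  proof (cases "w i v = 0 \<or> x i e = 0")
    case False
    then have "edge_dist \<alpha> J v e \<noteq> \<infinity>"
      using assms(3) that by (auto simp: finite_cost_def)
    moreover have "edge_dist \<alpha> J v e \<noteq> -\<infinity>"
      using edge_dist_ge[OF assms(1) that(3), of \<alpha> v] by auto
    ultimately show ?thesis by (cases "edge_dist \<alpha> J v e") auto
  qed (auto simp: zero_ereal_def[symmetric])
  have "objective \<alpha> Y J x w = (\<Sum>v\<in>verts J. \<Sum>i = 1..ndist J. \<Sum>e\<in>edges J.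
      ereal (w i v * real_of_ereal (edge_dist \<alpha> J v e) * x i e))"
    unfolding objective_def using assms(2) by (simp only: if_True) (intro sum.cong refl t)
  also have "\<dots> = ereal (\<Sum>v\<in>verts J. \<Sum>i = 1..ndist J. \<Sum>e\<in>edges J.
      w i v * real_of_ereal (edge_dist \<alpha> J v e) * x i e)"
    by simp
  also have "(\<Sum>v\<in>verts J. \<Sum>i = 1..ndist J. \<Sum>e\<in>edges J.
      w i v * real_of_ereal (edge_dist \<alpha> J v e) * x i e) = real_cost \<alpha> J x w"
    unfolding real_cost_def unit_cost_def sum_distrib_right
    by (subst sum.swap, subst (2) sum.swap, subst sum.swap) (rule refl)
  finally show ?thesis .
qed

lemma objective_infinite:
  assumes "GrpO \<in> Y" "\<not> finite_cost \<alpha> J x w"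
    and "\<And>i e. i \<in> {1..ndist J} \<Longrightarrow> e \<in> edges J \<Longrightarrow> 0 \<le> x i e"
    and "\<And>i v. i \<in> {1..ndist J} \<Longrightarrow> v \<in> verts J \<Longrightarrow> 0 \<le> w i v"
  shows "objective \<alpha> Y J x w = \<infinity>"
proof -
  obtain i v e where *: "i \<in> {1..ndist J}" "v \<in> verts J" "e \<in> edges J"
    "w i v \<noteq> 0" "x i e \<noteq> 0" "edge_dist \<alpha> J v e = \<infinity>"
    using assms(2) unfolding finite_cost_def by blast
  then have "0 < w i v" "0 < x i e"
    using assms(3)[of i e] assms(4)[of i v] by auto
  then have "ereal (w i v) * edge_dist \<alpha> J v e * ereal (x i e) = \<infinity>"
    using * by simp
  then have "(\<Sum>e\<in>edges J. ereal (w i v) * edge_dist \<alpha> J v e * ereal (x i e)) = \<infinity>"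
    using *(3) finite_edges unfolding sum_Pinfty by blast
  then have "(\<Sum>i = 1..ndist J. \<Sum>e\<in>edges J. ereal (w i v) * edge_dist \<alpha> J v e * ereal (x i e)) = \<infinity>"
    using *(1) unfolding sum_Pinfty by blast
  then show ?thesis
    using *(2) finite_verts assms(1) unfolding objective_def by (simp only: if_True sum_Pinfty) blast
qed

text \<open>Only a finite cost of the old solution needs an argument: otherwise its objective is
  infinite, and without an objective both sides are 0.\<close>

lemma objective_le:
  assumes "valid_instance form X J" "structural J x w"
    and "finite_cost \<alpha> J x w \<Longrightarrow> finite_cost \<alpha> J x' w' \<and> real_cost \<alpha> J x' w' \<le> real_cost \<alpha> J x w"
  shows "objective \<alpha> Y J x' w' \<le> objective \<alpha> Y J x w"
proof (cases "GrpO \<in> Y")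
  case True
  have w: "0 \<le> w i v" if "i \<in> {1..ndist J}" "v \<in> verts J" for i v
  proof -
    have "w i v \<in> {0, 1}" using assms(2) that unfolding structural_def by blast
    then show ?thesis by auto
  qed
  have x: "0 \<le> x i e" if "i \<in> {1..ndist J}" "e \<in> edges J" for i e
    using assms(2) that unfolding structural_def by blast
  show ?thesis
  proof (cases "finite_cost \<alpha> J x w")
    case True
    with assms objective_finite[OF assms(1) \<open>GrpO \<in> Y\<close>] show ?thesis by simp
  next
    case False
    then show ?thesis
      using objective_infinite[OF \<open>GrpO \<in> Y\<close> False x w] by simp
  qed
qed (simp add: objective_def)

lemma unit_cost_ge:
  assumes "valid_instance form X J" "structural J x w" "finite_cost \<alpha> J x w"
    and "i \<in> {1..ndist J}" "e \<in> edges J" "x i e \<noteq> 0"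
  shows "\<alpha> * weight J e \<le> unit_cost \<alpha> J w i e"
proof -
  have w: "w i v \<in> {0, 1}" if "v \<in> verts J" for v
    using assms(2,4) that unfolding structural_def by blast
  have "\<alpha> * weight J e = (\<Sum>v\<in>verts J. w i v * (\<alpha> * weight J e))"
    using assms(2,4) unfolding structural_def by (simp add: sum_distrib_right[symmetric])
  also have "\<dots> \<le> unit_cost \<alpha> J w i e"
    unfolding unit_cost_def
  proof (rule sum_mono)
    fix v assume v: "v \<in> verts J"
    show "w i v * (\<alpha> * weight J e) \<le> w i v * real_of_ereal (edge_dist \<alpha> J v e)"
    proof (cases "w i v = 0")
      case False
      then have "w i v = 1" "edge_dist \<alpha> J v e \<noteq> \<infinity>"
        using w[OF v] assms v by (auto simp: finite_cost_def)
      then show ?thesis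
        using edge_dist_ge[OF assms(1,5), of \<alpha> v] by (cases "edge_dist \<alpha> J v e") auto
    qed simp
  qed
  finally show ?thesis .
qed

text \<open>The shares of \<open>e\<close> sum to 1, and every district with a nonzero share pays at
  least this rate.\<close>

lemma edge_cost_ge:
  assumes "valid_instance form X J" "structural J x w" "finite_cost \<alpha> J x w" "e \<in> edges J"
  shows "\<alpha> * weight J e \<le> (\<Sum>i = 1..ndist J. unit_cost \<alpha> J w i e * x i e)"
proof -
  have "\<alpha> * weight J e = (\<Sum>i = 1..ndist J. \<alpha> * weight J e * x i e)"
    using assms(2,4) unfolding structural_def by (simp add: sum_distrib_left[symmetric])
  also have "\<dots> \<le> (\<Sum>i = 1..ndist J. unit_cost \<alpha> J w i e * x i e)"
  proof (rule sum_mono)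
    fix i assume i: "i \<in> {1..ndist J}"
    have "0 \<le> x i e" using assms(2,4) i unfolding structural_def by blast
    then show "\<alpha> * weight J e * x i e \<le> unit_cost \<alpha> J w i e * x i e"
      using unit_cost_ge[OF assms(1-3) i assms(4)] by (cases "x i e = 0") (auto intro: mult_right_mono)
  qed
  finally show ?thesis .
qed

text \<open>Every component of the edge set \<open>S\<close> meets \<open>W\<close>, expressed
  through cuts so as to match the contiguity inequalities.\<close>

definition conn :: "'v set set \<Rightarrow> 'v set \<Rightarrow> bool" where
  "conn S W \<longleftrightarrow> (\<forall>D \<subseteq> S. D \<noteq> {} \<longrightarrow> (\<exists>f \<in> S - D. f \<inter> \<Union>D \<noteq> {}) \<or> \<Union>D \<inter> W \<noteq> {})"

lemma connD:
  "conn S W \<Longrightarrow> D \<subseteq> S \<Longrightarrow> D \<noteq> {} \<Longrightarrow> (\<exists>f \<in> S - D. f \<inter> \<Union>D \<noteq> {}) \<or> \<Union>D \<inter> W \<noteq> {}"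
  by (simp add: conn_def)

lemma conn_insert_center:
  assumes "conn A W" "e \<inter> W \<noteq> {}"
  shows "conn (insert e A) W"
  unfolding conn_def
proof (intro allI impI)
  fix D assume D: "D \<subseteq> insert e A" "D \<noteq> {}"
  show "(\<exists>f \<in> insert e A - D. f \<inter> \<Union>D \<noteq> {}) \<or> \<Union>D \<inter> W \<noteq> {}"
  proof (cases "e \<in> D")
    case True
    then have "e \<inter> W \<subseteq> \<Union>D \<inter> W" by auto
    then have "\<Union>D \<inter> W \<noteq> {}" using assms(2) by (metis subset_empty)
    then show ?thesis by (rule disjI2)
  next
    case False
    then have "D \<subseteq> A" "A - D \<subseteq> insert e A - D" using D(1) by auto
    with connD[OF assms(1) _ D(2)] show ?thesis by (meson subsetD)
  qed
qed

text \<open>If \<open>D\<close> contains \<open>e\<close> but not \<open>f\<close>, then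
  \<open>f\<close> leads out of \<open>D\<close>. Otherwise removing \<open>e\<close> leaves a
  nonempty subset of \<open>A\<close>, and its exit serves \<open>D\<close> too.\<close>

lemma conn_insert_neighbour:
  assumes "conn A W" "f \<in> A" "f \<noteq> e" "f \<inter> e \<noteq> {}"
  shows "conn (insert e A) W"
  unfolding conn_def
proof (intro allI impI)
  fix D assume D: "D \<subseteq> insert e A" "D \<noteq> {}"
  show "(\<exists>f \<in> insert e A - D. f \<inter> \<Union>D \<noteq> {}) \<or> \<Union>D \<inter> W \<noteq> {}"
  proof (cases "e \<in> D \<and> f \<notin> D")
    case True
    moreover from this have "f \<inter> e \<subseteq> f \<inter> \<Union>D" by auto
    ultimately show ?thesis using assms(2,4) by (intro disjI1 bexI[of _ f]) auto
  next
    case False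
    define D' where "D' = D - {e}"
    have D': "D' \<subseteq> A" "D' \<noteq> {}" "\<Union>D' \<subseteq> \<Union>D"
      using D False assms(3) by (auto simp: D'_def)
    from connD[OF assms(1) D'(1,2)] show ?thesis
    proof
      assume "\<exists>g \<in> A - D'. g \<inter> \<Union>D' \<noteq> {}"
      then obtain g where g: "g \<in> A - D'" "g \<inter> \<Union>D' \<noteq> {}" by blast
      show ?thesis
      proof (cases "g \<in> D")
        case True
        \<comment> \<open>The witness lies in \<open>D\<close> only if it is the removed edge
          \<open>e\<close>; then \<open>e\<close> was in \<open>A\<close> already and inserting it
          changes nothing.\<close>
        then have "D = insert e D'" "g = e" using g(1) by (auto simp: D'_def)
        then have "e \<in> A" using g(1) by simp
        then have "insert e A = A" by auto
        then show ?thesis using connD[OF assms(1), of D] D by simp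
      next
        case False
        have "g \<inter> \<Union>D' \<subseteq> g \<inter> \<Union>D" using D'(3) by (intro Int_mono) simp_all
        then have "g \<inter> \<Union>D \<noteq> {}" using g(2) by (metis subset_empty)
        moreover have "g \<in> insert e A - D" using g(1) False by simp
        ultimately show ?thesis by (intro disjI1 bexI[of _ g])
      qed
    next
      assume "\<Union>D' \<inter> W \<noteq> {}"
      moreover have "\<Union>D' \<inter> W \<subseteq> \<Union>D \<inter> W" using D'(3) by (intro Int_mono) simp_all
      ultimately have "\<Union>D \<inter> W \<noteq> {}" by (metis subset_empty)
      then show ?thesis by (rule disjI2)
    qed
  qed
qed

text \<open>A maximal proper connected subset misses exactly one edge.\<close>

lemma conn_peel:
  assumes "finite S" "conn S W" "S \<noteq> {}"
  obtains e where "e \<in> S" "conn (S - {e}) W"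
proof -
  define P where "P A \<longleftrightarrow> A \<subset> S \<and> conn A W" for A
  have "P {}" using assms(3) by (auto simp: P_def conn_def)
  moreover have "card A < Suc (card S)" if "P A" for A
    using that assms(1) psubset_card_mono[of S A] by (simp add: P_def)
  ultimately obtain A where A: "P A" and max: "\<And>B. P B \<Longrightarrow> card B \<le> card A"
    using ex_has_greatest_nat[of P "{}" card "Suc (card S)"] by (metis less_imp_le)
  have finA: "finite A" using A assms(1) by (auto simp: P_def intro: finite_subset)
  \<comment> \<open>Either the complement \<open>S - A\<close> touches \<open>W\<close> and an edge
    there can be added, or connectivity of \<open>S\<close> yields a neighbour \<open>f\<close> in
    \<open>A\<close> of some edge in it. Maximality then forces
    \<open>insert e A = S\<close>.\<close>
  have "\<exists>e \<in> S - A. conn (insert e A) W"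
  proof (cases "\<Union>(S - A) \<inter> W = {}")
    case True
    moreover have "S - A \<subseteq> S" "S - A \<noteq> {}" using A by (auto simp: P_def)
    ultimately obtain f where f: "f \<in> S - (S - A)" "f \<inter> \<Union>(S - A) \<noteq> {}"
      using connD[OF assms(2), of "S - A"] by blast
    then obtain e where "e \<in> S - A" "f \<inter> e \<noteq> {}" by blast
    with f(1) conn_insert_neighbour[of A W f e] A show ?thesis
      unfolding P_def by (intro bexI[of _ e]) auto
  next
    case False
    then obtain e where "e \<in> S - A" "e \<inter> W \<noteq> {}" by blast
    with conn_insert_center[of A W e] A show ?thesis
      unfolding P_def by (intro bexI[of _ e]) auto
  qed
  then obtain e where e: "e \<in> S" "e \<notin> A" "conn (insert e A) W" by blast
  then have "\<not> P (insert e A)"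
    using max[of "insert e A"] finA by auto
  then have "insert e A = S"
    using e A unfolding P_def by blast
  then have "S - {e} = A" using e by blast
  then show ?thesis using that[of e] e A by (simp add: P_def)
qed

lemma zero_one_sum_ge_1:
  fixes f :: "'a \<Rightarrow> real"
  assumes "finite A" "\<forall>a\<in>A. f a \<in> {0, 1}"
  shows "0 \<le> sum f A" "sum f A < 1 \<Longrightarrow> a \<in> A \<Longrightarrow> f a = 0"
proof -
  have nn: "0 \<le> f a" if "a \<in> A" for a using assms(2) that by fastforce
  then show "0 \<le> sum f A" by (rule sum_nonneg)
  have ge: "1 \<le> sum f A" if "a \<in> A" "f a = 1" for a
    using member_le_sum[of a A f] that assms(1) nn by auto
  show "f a = 0" if "sum f A < 1" "a \<in> A" using ge[of a] assms(2) that by fastforce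
qed

text \<open>All terms of the three sums are 0 or 1, so the inequality says that some term is
  nonzero: a further edge of the district touches \<open>D\<close>, an edge of \<open>D\<close> is
  outside the district, or its center lies on \<open>D\<close>.\<close>

lemma integral_contiguous_iff:
  assumes "valid_instance form X J"
    and x: "\<And>i e. i \<in> {1..ndist J} \<Longrightarrow> e \<in> edges J \<Longrightarrow> x i e \<in> {0, 1}"
    and w: "\<And>i v. i \<in> {1..ndist J} \<Longrightarrow> v \<in> verts J \<Longrightarrow> w i v \<in> {0, 1}"
  shows "contiguous J x w \<longleftrightarrow>
    (\<forall>i \<in> {1..ndist J}. conn {e \<in> edges J. x i e = 1} {v. w i v = 1})"
proof -
  have "1 \<le> (\<Sum>e\<in>boundary J D. x i e) + (\<Sum>e\<in>D. 1 - x i e) + (\<Sum>v\<in>\<Union>D. w i v) \<longleftrightarrow>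
      (D \<subseteq> {e \<in> edges J. x i e = 1} \<longrightarrow>
        (\<exists>f \<in> {e \<in> edges J. x i e = 1} - D. f \<inter> \<Union>D \<noteq> {}) \<or> \<Union>D \<inter> {v. w i v = 1} \<noteq> {})"
    (is "?l \<longleftrightarrow> ?r") if D: "D \<subseteq> edges J" and i: "i \<in> {1..ndist J}" for D i
  proof -
    have DV: "\<Union>D \<subseteq> verts J" "finite (\<Union>D)"
      using D edge_subset_verts[OF assms(1)] finite_subset[OF _ finite_verts, of "\<Union>D" J] by blast+
    have fin: "finite (boundary J D)" "finite D"
      using finite_edges[of J] D by (auto simp: boundary_def intro: finite_subset)
    have b: "\<forall>e \<in> boundary J D. x i e \<in> {0, 1}"
      using x[OF i] by (simp add: boundary_def)
    have d: "\<forall>e \<in> D. 1 - x i e \<in> {0, 1}"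
      using x[OF i] D by force
    have v: "\<forall>u \<in> \<Union>D. w i u \<in> {0, 1}"
      using w[OF i] DV by blast
    note zb = zero_one_sum_ge_1[of _ "x i", OF fin(1) b]
      and zd = zero_one_sum_ge_1[of _ "\<lambda>e. 1 - x i e", OF fin(2) d]
      and zv = zero_one_sum_ge_1[of _ "w i", OF DV(2) v]
    show ?thesis
    proof
      assume ?l
      show ?r
      proof (rule ccontr)
        assume n: "\<not> ?r"
        then have n1: "D \<subseteq> {e \<in> edges J. x i e = 1}" and n3: "\<Union>D \<inter> {v. w i v = 1} = {}"
          and n2: "\<And>f. f \<in> {e \<in> edges J. x i e = 1} - D \<Longrightarrow> f \<inter> \<Union>D = {}"
          by blast+
        have "(\<Sum>e\<in>D. 1 - x i e) = 0"
          using n1 by (intro sum.neutral) auto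
        moreover have "(\<Sum>e\<in>boundary J D. x i e) = 0"
        proof (intro sum.neutral ballI)
          fix e assume e: "e \<in> boundary J D"
          then have "x i e \<noteq> 1" using n2[of e] unfolding boundary_def by blast
          then show "x i e = 0" using b e by auto
        qed
        moreover have "(\<Sum>v\<in>\<Union>D. w i v) = 0"
        proof (intro sum.neutral ballI)
          fix u assume u: "u \<in> \<Union>D"
          then have "w i u \<noteq> 1" using n3 by blast
          then show "w i u = 0" using v u by auto
        qed
        ultimately show False using \<open>?l\<close> by simp
      qed
    next
      assume r: ?r
      show ?l
      proof (rule ccontr)
        assume "\<not> ?l"
        then have lt: "(\<Sum>e\<in>boundary J D. x i e) < 1" "(\<Sum>e\<in>D. 1 - x i e) < 1" "(\<Sum>v\<in>\<Union>D. w i v) < 1"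
          using zb(1) zd(1) zv(1) by linarith+
        have "D \<subseteq> {e \<in> edges J. x i e = 1}"
          using zd(2)[OF lt(2)] D by force
        moreover have "f \<inter> \<Union>D = {}" if "f \<in> {e \<in> edges J. x i e = 1} - D" for f
          using zb(2)[OF lt(1), of f] that by (auto simp: boundary_def)
        moreover have "\<Union>D \<inter> {v. w i v = 1} = {}"
          using zv(2)[OF lt(3)] by force
        ultimately show False using r by blast
      qed
    qed
  qed
  note key = this
  show ?thesis
  proof
    assume c: "contiguous J x w"
    show "\<forall>i \<in> {1..ndist J}. conn {e \<in> edges J. x i e = 1} {v. w i v = 1}"
      unfolding conn_def
    proof (intro ballI allI impI)
      fix i D assume i: "i \<in> {1..ndist J}" and D: "D \<subseteq> {e \<in> edges J. x i e = 1}" "D \<noteq> {}"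
      have DE: "D \<subseteq> edges J" using D(1) by auto
      have "1 \<le> (\<Sum>e\<in>boundary J D. x i e) + (\<Sum>e\<in>D. 1 - x i e) + (\<Sum>v\<in>\<Union>D. w i v)"
        using c i DE D(2) by (simp add: contiguous_def)
      from mp[OF iffD1[OF key[OF DE i] this] D(1)]
      show "(\<exists>f \<in> {e \<in> edges J. x i e = 1} - D. f \<inter> \<Union>D \<noteq> {}) \<or> \<Union>D \<inter> {v. w i v = 1} \<noteq> {}" .
    qed
  next
    assume c: "\<forall>i \<in> {1..ndist J}. conn {e \<in> edges J. x i e = 1} {v. w i v = 1}"
    show "contiguous J x w"
      unfolding contiguous_def
    proof (intro ballI allI impI)
      fix i D assume i: "i \<in> {1..ndist J}" and D: "D \<subseteq> edges J \<and> D \<noteq> {}"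
      show "1 \<le> (\<Sum>e\<in>boundary J D. x i e) + (\<Sum>e\<in>D. 1 - x i e) + (\<Sum>v\<in>\<Union>D. w i v)"
      proof (rule iffD2[OF key[OF conjunct1[OF D] i]], rule impI)
        assume "D \<subseteq> {e \<in> edges J. x i e = 1}"
        from connD[OF bspec[OF c i] this conjunct2[OF D]]
        show "(\<exists>f \<in> {e \<in> edges J. x i e = 1} - D. f \<inter> \<Union>D \<noteq> {}) \<or> \<Union>D \<inter> {v. w i v = 1} \<noteq> {}" .
      qed
    qed
  qed
qed

section \<open>Filling empty districts: integral assignments\<close>

definition empty_districts :: "districting \<Rightarrow> assignment \<Rightarrow> nat set" where
  "empty_districts J x = {i \<in> {1..ndist J}. \<forall>e\<in>edges J. x i e = 0}"

lemma finite_empty_districts: "finite (empty_districts J x)"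
  by (simp add: empty_districts_def)

text \<open>Edges are moved one at a time into an empty district, whose center becomes an endpoint of the
  edge: this costs \<open>\<alpha> b\<^sub>e\<close>, the least that any district can pay for it.\<close>

lemma fill_empty_district:
  assumes val: "valid_instance form X J"
    and X: "GrpN \<in> X" "GrpB \<notin> X" "GrpI \<in> X"
    and feas: "feasible form X J x w" and i: "i \<in> empty_districts J x"
  obtains x' w' where "feasible form X J x' w'" "objective \<alpha> X J x' w' \<le> objective \<alpha> X J x w"
    "empty_districts J x' \<subset> empty_districts J x"
proof -
  let ?P = "{1..ndist J}"
  have str: "structural J x w" using feas by (simp add: feasible_def)
  have x01: "x k e \<in> {0, 1}" if "k \<in> ?P" "e \<in> edges J" for k e
    using feas X(3) that unfolding feasible_def by simp
  have w01: "w k v \<in> {0, 1}" if "k \<in> ?P" "v \<in> verts J" for k v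
    using str that unfolding structural_def by blast
  have sum1: "(\<Sum>k\<in>?P. x k e) = 1" if "e \<in> edges J" for e
    using str that unfolding structural_def by blast
  have iP: "i \<in> ?P" and xi: "\<And>e. e \<in> edges J \<Longrightarrow> x i e = 0"
    using i by (auto simp: empty_districts_def)
  define S where "S k = {e \<in> edges J. x k e = 1}" for k
  have finS: "finite (S k)" for k by (simp add: S_def finite_edges)
  have owner: "\<exists>k\<in>?P - {i}. e \<in> S k" if "e \<in> edges J" for e
  proof (rule ccontr)
    assume *: "\<not> ?thesis"
    have "x k e = 0" if "k \<in> ?P" for k
      using * x01[OF that \<open>e \<in> edges J\<close>] xi[OF \<open>e \<in> edges J\<close>] that \<open>e \<in> edges J\<close>
      by (cases "k = i") (auto simp: S_def)
    then show False using sum1[OF \<open>e \<in> edges J\<close>] by simp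
  qed
  \<comment> \<open>Pigeonhole: at least \<open>p\<close> edges are spread over at most
    \<open>p - 1\<close> districts. A donor with two edges does not become empty, so the number of
    empty districts really drops.\<close>
  have "\<exists>j\<in>?P - {i}. 2 \<le> card (S j)"
  proof (rule ccontr)
    assume *: "\<not> ?thesis"
    have "edges J \<subseteq> (\<Union>k\<in>?P - {i}. S k)" using owner by blast
    then have "card (edges J) \<le> card (\<Union>k\<in>?P - {i}. S k)"
      using finS by (intro card_mono) auto
    also have "\<dots> \<le> (\<Sum>k\<in>?P - {i}. card (S k))" by (rule card_UN_le) simp
    also have "\<dots> \<le> (\<Sum>k\<in>?P - {i}. 1)" using * by (intro sum_mono) force
    also have "\<dots> < ndist J" using iP by simp
    finally show False using val by (simp add: valid_instance_def)
  qed
  then obtain j where j: "j \<in> ?P" "j \<noteq> i" "2 \<le> card (S j)" by blast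
  then have Sj: "S j \<noteq> {}" by auto
  define W where "W k = {v. w k v = 1}" for k
  have "\<exists>e\<in>S j. GrpC \<in> X \<longrightarrow> conn (S j - {e}) (W j)"
  proof (cases "GrpC \<in> X")
    case True
    then have "contiguous J x w" using feas by (simp add: feasible_def)
    then have "conn (S j) (W j)"
      using integral_contiguous_iff[OF val x01 w01] j(1) by (simp add: S_def W_def)
    from conn_peel[OF finS this Sj] show ?thesis by blast
  qed (use Sj in auto)
  then obtain e where e: "e \<in> S j" "GrpC \<in> X \<Longrightarrow> conn (S j - {e}) (W j)" by blast
  have eE: "e \<in> edges J" and xje: "x j e = 1" using e(1) by (auto simp: S_def)
  obtain u where u: "u \<in> e" "u \<in> verts J" using edge_subset_verts[OF val eE] by blast
  have others: "x k e = 0" if "k \<in> ?P" "k \<noteq> j" for k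
  proof -
    have "(\<Sum>k\<in>?P. x k e) = x j e + (\<Sum>k\<in>?P - {j}. x k e)"
      using j(1) by (intro sum.remove) auto
    then have "(\<Sum>k\<in>?P - {j}. x k e) = 0" using sum1[OF eE] xje by simp
    moreover have "0 \<le> x k e" if "k \<in> ?P - {j}" for k
      using x01[of k, OF _ eE] that by force
    ultimately show ?thesis using that by (subst (asm) sum_nonneg_eq_0_iff) auto
  qed
  define x' where "x' = (\<lambda>k f. if f = e then (if k = i then 1 else 0) else x k f)"
  define w' where "w' = (\<lambda>k v. if k = i then (if v = u then 1 else 0) else w k v)"
  have x'01: "x' k f \<in> {0, 1}" if "k \<in> ?P" "f \<in> edges J" for k f
    using x01[OF that] by (simp add: x'_def)
  have w'01: "w' k v \<in> {0, 1}" if "k \<in> ?P" "v \<in> verts J" for k v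
    using w01[OF that] by (simp add: w'_def)
  have sum1': "(\<Sum>k\<in>?P. x' k f) = 1" if "f \<in> edges J" for f
    using sum1[OF that] iP by (cases "f = e") (simp_all add: x'_def)
  have sumw: "(\<Sum>v\<in>verts J. w' k v) = 1" if "k \<in> ?P" for k
    using str that u(2) finite_verts by (cases "k = i") (simp_all add: w'_def structural_def)
  have str': "structural J x' w'"
    unfolding structural_def
  proof (intro conjI ballI)
    fix k f assume "k \<in> ?P" "f \<in> edges J"
    then show "0 \<le> x' k f" using x'01[of k f] by auto
  qed (use sum1' sumw w'01 in auto)
  define S' where "S' k = {f \<in> edges J. x' k f = 1}" for k
  have S': "S' i = {e}" "S' j = S j - {e}" "\<And>k. k \<in> ?P \<Longrightarrow> k \<noteq> i \<Longrightarrow> k \<noteq> j \<Longrightarrow> S' k = S k"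
    using eE xi j(2) others by (auto simp: S'_def S_def x'_def)
  have cont: "contiguous J x' w'" if C: "GrpC \<in> X"
  proof -
    have c: "conn (S k) (W k)" if "k \<in> ?P" for k
      using feas C that integral_contiguous_iff[OF val x01 w01] by (simp add: S_def W_def feasible_def)
    have "conn (S' k) {v. w' k v = 1}" if k: "k \<in> ?P" for k
    proof -
      consider "k = i" | "k = j" | "k \<noteq> i" "k \<noteq> j" by blast
      then show ?thesis
      proof cases
        case 1
        have "conn {} {u}" by (simp add: conn_def)
        from conn_insert_center[OF this, of e] u(1) show ?thesis
          using 1 by (simp add: S'(1) w'_def)
      next
        case 2
        then show ?thesis using e(2)[OF C] j(2) by (simp add: S'(2) w'_def W_def)
      next
        case 3
        then show ?thesis using c[OF k] by (simp add: S'(3)[OF k] w'_def W_def)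
      qed
    qed
    then show ?thesis
      using integral_contiguous_iff[OF val x'01 w'01] by (simp add: S'_def)
  qed
  have feas': "feasible form X J x' w'"
    unfolding feasible_def using str' cont X x'01 by auto
  have cost: "finite_cost \<alpha> J x' w' \<and> real_cost \<alpha> J x' w' \<le> real_cost \<alpha> J x w" if fin: "finite_cost \<alpha> J x w"
  proof
    show "finite_cost \<alpha> J x' w'"
      unfolding finite_cost_def
    proof (intro ballI impI)
      fix k v f assume *: "k \<in> ?P" "v \<in> verts J" "f \<in> edges J" "w' k v \<noteq> 0" "x' k f \<noteq> 0"
      show "edge_dist \<alpha> J v f \<noteq> \<infinity>"
      proof (cases "k = i")
        case True
        then have "f = e" "v = u"
          using * xi by (auto simp: x'_def w'_def split: if_splits)
        then show ?thesis using edge_dist_endpoint[OF val eE u(1)] by simp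
      next
        case False
        then have "x k f \<noteq> 0" "w k v \<noteq> 0"
          using * by (auto simp: x'_def w'_def split: if_splits)
        then show ?thesis using fin * by (auto simp: finite_cost_def)
      qed
    qed
    have ui: "unit_cost \<alpha> J w' i e = \<alpha> * weight J e"
    proof -
      have "unit_cost \<alpha> J w' i e = (\<Sum>v\<in>verts J. if v = u then \<alpha> * weight J e else 0)"
        unfolding unit_cost_def
        by (rule sum.cong) (auto simp: w'_def edge_dist_endpoint[OF val eE u(1)])
      then show ?thesis using u(2) finite_verts by simp
    qed
    show "real_cost \<alpha> J x' w' \<le> real_cost \<alpha> J x w"
      unfolding real_cost_def
    proof (rule sum_mono)
      fix f assume f: "f \<in> edges J"
      show "(\<Sum>k\<in>?P. unit_cost \<alpha> J w' k f * x' k f) \<le> (\<Sum>k\<in>?P. unit_cost \<alpha> J w k f * x k f)"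
      proof (cases "f = e")
        case True
        have "(\<Sum>k\<in>?P. unit_cost \<alpha> J w' k e * x' k e) = (\<Sum>k\<in>?P. if k = i then \<alpha> * weight J e else 0)"
          by (rule sum.cong) (auto simp: x'_def ui)
        also have "\<dots> = \<alpha> * weight J e" using iP by simp
        also have "\<dots> \<le> (\<Sum>k\<in>?P. unit_cost \<alpha> J w k e * x k e)"
          by (rule edge_cost_ge[OF val str fin eE])
        finally show ?thesis by (simp only: True)
      next
        case False
        \<comment> \<open>District \<open>i\<close> has a new center but no share of
          \<open>f\<close>, so its term is 0 before and after.\<close>
        then have "unit_cost \<alpha> J w' k f * x' k f = unit_cost \<alpha> J w k f * x k f" for k
          using xi[OF f] by (cases "k = i") (simp_all add: x'_def w'_def unit_cost_def)
        then show ?thesis by simp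
      qed
    qed
  qed
  have "empty_districts J x' \<subseteq> empty_districts J x - {i}"
  proof
    fix k assume k: "k \<in> empty_districts J x'"
    then have kP: "k \<in> ?P" and k0: "\<And>f. f \<in> edges J \<Longrightarrow> x' k f = 0"
      by (auto simp: empty_districts_def)
    have ki: "k \<noteq> i" using k0[OF eE] by (auto simp: x'_def)
    have "k \<noteq> j"
    proof
      assume "k = j"
      then have "S j - {e} = {}" using k0 unfolding S'(2)[symmetric] S'_def by auto
      then have "card (S j) \<le> card {e}" by (intro card_mono) auto
      then show False using j(3) by simp
    qed
    then have "x k f = 0" if "f \<in> edges J" for f
      using k0[OF that] others[OF kP] by (cases "f = e") (simp_all add: x'_def)
    then show "k \<in> empty_districts J x - {i}"
      using kP ki by (simp add: empty_districts_def)
  qed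
  then have "empty_districts J x' \<subset> empty_districts J x" using i by blast
  with feas' objective_le[OF val str cost] that show ?thesis by blast
qed

lemma integral_nonempty:
  assumes val: "valid_instance form X J"
    and X: "GrpN \<in> X" "GrpB \<notin> X" "GrpI \<in> X"
    and feas: "feasible form X J x w"
  shows "\<exists>x' w'. feasible form X J x' w' \<and> objective \<alpha> X J x' w' \<le> objective \<alpha> X J x w \<and>
    (\<forall>i\<in>{1..ndist J}. \<exists>e\<in>edges J. x' i e = 1)"
  using feas
proof (induction "card (empty_districts J x)" arbitrary: x w rule: less_induct)
  case less
  show ?case
  proof (cases "empty_districts J x = {}")
    case True
    have "\<exists>e\<in>edges J. x i e = 1" if i: "i \<in> {1..ndist J}" for i
    proof -
      obtain e where "e \<in> edges J" "x i e \<noteq> 0" using True i by (auto simp: empty_districts_def)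
      moreover have "x i e \<in> {0, 1}" using less.prems X(3) i \<open>e \<in> edges J\<close> unfolding feasible_def by simp
      ultimately show ?thesis by auto
    qed
    then show ?thesis using less.prems by blast
  next
    case False
    then obtain i where "i \<in> empty_districts J x" by blast
    from fill_empty_district[OF val X less.prems this] obtain x' w' where
      *: "feasible form X J x' w'" "objective \<alpha> X J x' w' \<le> objective \<alpha> X J x w"
      "empty_districts J x' \<subset> empty_districts J x" by blast
    from less.hyps[OF psubset_card_mono[OF finite_empty_districts *(3)] *(1)] *(2)
    show ?thesis by (meson order_trans)
  qed
qed

section \<open>Filling empty districts: fractional assignments\<close>

text \<open>The constraints on \<open>x\<close> for fixed \<open>w\<close>, as coefficients with a
  lower bound; equations become two opposite rows. The center terms and the \<open>card D\<close>
  from the sum of \<open>1 - x\<close> are integer constants and move to the right-hand side, which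
  leaves coefficients -1, 0, 1.\<close>

definition district_rows :: "group set \<Rightarrow> districting \<Rightarrow> selection \<Rightarrow> ((nat \<times> nat set \<Rightarrow> real) \<times> real) set" where
  "district_rows X J w =
     (\<lambda>k. (\<lambda>v. if v = k then 1 else 0, 0)) ` ({1..ndist J} \<times> edges J) \<union>
     (\<lambda>e. (\<lambda>v. if snd v = e then 1 else 0, 1)) ` edges J \<union>
     (\<lambda>e. (\<lambda>v. if snd v = e then -1 else 0, -1)) ` edges J \<union>
     (if GrpC \<in> X then
       (\<lambda>(i, D). (\<lambda>v. if fst v = i then (if snd v \<in> boundary J D then 1 else if snd v \<in> D then -1 else 0) else 0,
          1 - real (card D) - (\<Sum>u\<in>\<Union>D. w i u))) ` ({1..ndist J} \<times> (Pow (edges J) - {{}}))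
      else {})"

lemma finite_district_rows: "finite (district_rows X J w)"
  by (simp add: district_rows_def finite_edges)

text \<open>There is a contiguity row for every district and every nonempty edge set. Exponentially
  many rows are harmless, since only the logarithm of their number enters the tolerance.\<close>

lemma card_district_rows:
  "card (district_rows X J w) \<le> ndist J * card (edges J) + 2 * card (edges J) + ndist J * 2 ^ card (edges J)"
proof -
  let ?P = "{1..ndist J}" and ?E = "edges J"
  have fin: "finite (?P \<times> ?E)" "finite ?E" "finite (?P \<times> (Pow ?E - {{}}))"
    by (simp_all add: finite_edges)
  have c: "card (?P \<times> (Pow ?E - {{}})) \<le> ndist J * 2 ^ card ?E"
    unfolding card_cartesian_product
    using card_mono[of "Pow ?E" "Pow ?E - {{}}"] by (simp add: finite_edges card_Pow)
  show ?thesis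
    unfolding district_rows_def
    by (rule order_trans[OF card_Un_le add_mono[OF order_trans[OF card_Un_le
          add_mono[OF order_trans[OF card_Un_le add_mono[OF card_image_le card_image_le]] card_image_le]]
          order_trans[of _ "card (?P \<times> (Pow ?E - {{}}))"]], THEN order_trans])
      (use fin c card_image_le[OF fin(3)] in \<open>auto simp: card_cartesian_product\<close>)
qed

lemma district_rows_integral:
  assumes val: "valid_instance form X J" and w: "\<And>i v. i \<in> {1..ndist J} \<Longrightarrow> v \<in> verts J \<Longrightarrow> w i v \<in> {0, 1}"
    and r: "r \<in> district_rows X J w"
  shows "fst r v \<in> \<int> \<and> \<bar>fst r v\<bar> \<le> 1" "snd r \<in> \<int>"
proof -
  have sums: "(\<Sum>u\<in>\<Union>D. w i u) \<in> \<int>" if "i \<in> {1..ndist J}" "D \<subseteq> edges J" for i D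
  proof (rule Ints_sum)
    fix u assume "u \<in> \<Union>D"
    then have "u \<in> verts J" using that(2) edge_subset_verts(1)[OF val] by blast
    with w[OF that(1)] show "w i u \<in> \<int>" by fastforce
  qed
  from r show "fst r v \<in> \<int> \<and> \<bar>fst r v\<bar> \<le> 1"
    unfolding district_rows_def by (auto split: if_splits)
  from r show "snd r \<in> \<int>"
    unfolding district_rows_def using sums by (auto split: if_splits)
qed

section \<open>The rows evaluated at an assignment\<close>

context
  fixes J :: districting and I :: "(nat \<times> nat set) set"
  defines "I \<equiv> {1..ndist J} \<times> edges J"
begin

lemma lin_pairs: "lin I a y = (\<Sum>i = 1..ndist J. \<Sum>e\<in>edges J. a (i, e) * y (i, e))"
  unfolding lin_def I_def by (subst sum.cartesian_product) (simp add: split_def)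

lemma lin_unit: "k \<in> I \<Longrightarrow> lin I (\<lambda>v. if v = k then 1 else 0) y = y k"
proof -
  assume k: "k \<in> I"
  have "lin I (\<lambda>v. if v = k then 1 else 0) y = (\<Sum>v\<in>I. if v = k then y v else 0)"
    unfolding lin_def by (rule sum.cong) auto
  also have "\<dots> = y k" using k by (simp add: I_def finite_edges)
  finally show ?thesis .
qed

lemma lin_edge:
  assumes "e \<in> edges J"
  shows "lin I (\<lambda>v. if snd v = e then c else 0) y = c * (\<Sum>i = 1..ndist J. y (i, e))"
proof -
  have "lin I (\<lambda>v. if snd v = e then c else 0) y
      = (\<Sum>i = 1..ndist J. \<Sum>f\<in>edges J. if f = e then c * y (i, f) else 0)"
    unfolding lin_pairs by (intro sum.cong refl) simp
  also have "\<dots> = c * (\<Sum>i = 1..ndist J. y (i, e))"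
    using assms by (simp add: finite_edges sum_distrib_left)
  finally show ?thesis .
qed

lemma lin_district:
  assumes "i \<in> {1..ndist J}" "D \<subseteq> edges J"
  shows "lin I (\<lambda>v. if fst v = i then (if snd v \<in> boundary J D then 1 else if snd v \<in> D then -1 else 0) else 0) y
    = (\<Sum>e\<in>boundary J D. y (i, e)) - (\<Sum>e\<in>D. y (i, e))"
proof -
  let ?a = "\<lambda>f. if f \<in> boundary J D then 1 else if f \<in> D then -1 else (0::real)"
  have "lin I (\<lambda>v. if fst v = i then ?a (snd v) else 0) y
      = (\<Sum>k = 1..ndist J. if k = i then \<Sum>f\<in>edges J. ?a f * y (i, f) else 0)"
    unfolding lin_pairs by (intro sum.cong refl) (auto intro!: sum.cong)
  also have "\<dots> = (\<Sum>f\<in>edges J. ?a f * y (i, f))"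
    using assms(1) by simp
  \<comment> \<open>\<open>boundary J D\<close> and \<open>D\<close> are disjoint, so the nested
    conditional is a difference of two indicators.\<close>
  also have "\<dots> = (\<Sum>f\<in>edges J. (if f \<in> boundary J D then y (i, f) else 0) - (if f \<in> D then y (i, f) else 0))"
    by (rule sum.cong) (auto simp: boundary_def)
  also have "\<dots> = (\<Sum>f\<in>boundary J D. y (i, f)) - (\<Sum>f\<in>D. y (i, f))"
  proof -
    have "boundary J D \<subseteq> edges J" by (auto simp: boundary_def)
    then show ?thesis
      using assms(2) by (simp add: sum_subtractf sum.If_cases finite_edges Int_absorb1)
  qed
  finally show ?thesis .
qed

lemma sat_district_rows_iff:
  "sat I (district_rows X J w) (\<lambda>(i, e). x i e) \<longleftrightarrow>
     (\<forall>i\<in>{1..ndist J}. \<forall>e\<in>edges J. 0 \<le> x i e) \<and> (\<forall>e\<in>edges J. (\<Sum>i = 1..ndist J. x i e) = 1) \<and>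
     (GrpC \<in> X \<longrightarrow> contiguous J x w)"
proof -
  let ?y = "\<lambda>(i, e). x i e"
  have 1: "(\<forall>r\<in>(\<lambda>k. (\<lambda>v. if v = k then 1 else 0, 0)) ` ({1..ndist J} \<times> edges J). snd r \<le> lin I (fst r) ?y)
      \<longleftrightarrow> (\<forall>i\<in>{1..ndist J}. \<forall>e\<in>edges J. 0 \<le> x i e)"
    using lin_unit[of _ ?y] unfolding I_def by auto
  have 2: "(\<forall>r\<in>(\<lambda>e. (\<lambda>v. if snd v = e then 1 else 0, 1)) ` edges J. snd r \<le> lin I (fst r) ?y) \<and>
      (\<forall>r\<in>(\<lambda>e. (\<lambda>v. if snd v = e then -1 else 0, -1)) ` edges J. snd r \<le> lin I (fst r) ?y)
      \<longleftrightarrow> (\<forall>e\<in>edges J. (\<Sum>i = 1..ndist J. x i e) = 1)"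
    by (simp add: lin_edge ball_conj_distrib[symmetric]) (intro ball_cong refl, linarith)
  have 3: "(\<forall>r\<in>(\<lambda>(i, D). (\<lambda>v. if fst v = i then (if snd v \<in> boundary J D then 1 else if snd v \<in> D then -1 else 0) else 0,
          1 - real (card D) - (\<Sum>u\<in>\<Union>D. w i u))) ` ({1..ndist J} \<times> (Pow (edges J) - {{}})). snd r \<le> lin I (fst r) ?y)
      \<longleftrightarrow> contiguous J x w"
  proof -
    have "(1 - real (card D) - (\<Sum>u\<in>\<Union>D. w i u) \<le> (\<Sum>e\<in>boundary J D. x i e) - (\<Sum>e\<in>D. x i e)) \<longleftrightarrow>
      ((\<Sum>e\<in>boundary J D. x i e) + (\<Sum>e\<in>D. 1 - x i e) + (\<Sum>u\<in>\<Union>D. w i u) \<ge> 1)" for i D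
      by (auto simp: sum_subtractf)
    then show ?thesis
      unfolding contiguous_def by (auto simp: lin_district)
  qed
  show ?thesis
    unfolding sat_def district_rows_def using 1 2 3 by (simp only: ball_Un if_split_mem1) (auto split: if_splits)
qed

lemma lin_real_cost: "lin I (\<lambda>(i, e). unit_cost \<alpha> J w i e) (\<lambda>(i, e). x i e) = real_cost \<alpha> J x w"
  unfolding lin_pairs real_cost_def by (subst sum.swap) simp

end

text \<open>The bound of \<open>vertex_round\<close> for \<open>p m\<close> variables and the row
  count of \<open>card_district_rows\<close>: nonzero vertex coordinates are at least its
  reciprocal.\<close>

definition vertex_bound :: "nat \<Rightarrow> nat \<Rightarrow> nat" where
  "vertex_bound p m = fact (p * m) * (p * m + 2 * m + p * 2 ^ m) ^ (p * m)"

text \<open>The centers \<open>w\<close> stay as they are: only for fixed \<open>w\<close> do the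
  constraints and the cost become linear in \<open>x\<close>.\<close>

lemma fractional_round:
  assumes val: "valid_instance form X J"
    and X: "GrpN \<in> X" "GrpB \<notin> X" "GrpI \<notin> X"
    and feas: "feasible form X J x w"
  obtains y where "feasible form X J y w" "objective \<alpha> X J y w \<le> objective \<alpha> X J x w"
    "\<And>i e. i \<in> {1..ndist J} \<Longrightarrow> e \<in> edges J \<Longrightarrow> y i e \<noteq> 0 \<Longrightarrow>
       1 \<le> real (vertex_bound (ndist J) (card (edges J))) * y i e"
proof -
  let ?P = "{1..ndist J}"
  define I where "I = ?P \<times> edges J"
  have cardI: "card I = ndist J * card (edges J)" by (simp add: I_def card_cartesian_product)
  have finI: "finite I" by (simp add: I_def finite_edges)
  have str: "structural J x w" using feas by (simp add: feasible_def)
  have w01: "w k v \<in> {0, 1}" if "k \<in> ?P" "v \<in> verts J" for k v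
    using str that unfolding structural_def by blast
  have satx: "sat I (district_rows X J w) (\<lambda>(i, e). x i e)"
    using feas unfolding I_def sat_district_rows_iff feasible_def structural_def by blast
  have bd: "z i e \<le> 1" if "\<forall>i\<in>?P. \<forall>e\<in>edges J. 0 \<le> z i e" "\<forall>e\<in>edges J. (\<Sum>i\<in>?P. z i e) = 1"
    "i \<in> ?P" "e \<in> edges J" for z :: assignment and i e
    using member_le_sum[of i ?P "\<lambda>i. z i e"] that by auto
  have bounded: "\<forall>y. sat I (district_rows X J w) y \<longrightarrow> (\<forall>v\<in>I. \<bar>y v\<bar> \<le> 1)"
  proof (intro allI impI ballI)
    fix y v assume y: "sat I (district_rows X J w) y" and v: "v \<in> I"
    define z where "z i e = y (i, e)" for i e
    have "y = (\<lambda>(i, e). z i e)" by (auto simp: z_def)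
    with y have "\<forall>i\<in>?P. \<forall>e\<in>edges J. 0 \<le> z i e" "\<forall>e\<in>edges J. (\<Sum>i\<in>?P. z i e) = 1"
      unfolding I_def using sat_district_rows_iff by blast+
    with bd[of z] v show "\<bar>y v\<bar> \<le> 1" by (auto simp: I_def z_def)
  qed
  have int: "fst r v \<in> \<int> \<and> \<bar>fst r v\<bar> \<le> 1" "snd r \<in> \<int>" if "r \<in> district_rows X J w" for r v
    using district_rows_integral[OF val w01 that] by simp_all
  obtain y' where y': "sat I (district_rows X J w) y'"
    "lin I (\<lambda>(i, e). unit_cost \<alpha> J w i e) y' \<le> lin I (\<lambda>(i, e). unit_cost \<alpha> J w i e) (\<lambda>(i, e). x i e)"
    "tight I (district_rows X J w) (\<lambda>(i, e). x i e) \<subseteq> tight I (district_rows X J w) y'"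
    and low: "\<And>v. v \<in> I \<Longrightarrow> y' v \<noteq> 0 \<Longrightarrow> 1 \<le> fact (card I) *
      real (ndist J * card (edges J) + 2 * card (edges J) + ndist J * 2 ^ card (edges J)) ^ card I * \<bar>y' v\<bar>"
    by (rule vertex_round[OF finite_district_rows finI bounded satx card_district_rows int, of "\<lambda>(i, e). unit_cost \<alpha> J w i e"])
      (assumption | rule that)+
  define y where "y i e = y' (i, e)" for i e
  have yy: "y' = (\<lambda>(i, e). y i e)" by (auto simp: y_def)
  have y0: "\<forall>i\<in>?P. \<forall>e\<in>edges J. 0 \<le> y i e" and y1: "\<forall>e\<in>edges J. (\<Sum>i\<in>?P. y i e) = 1"
    and yC: "GrpC \<in> X \<longrightarrow> contiguous J y w"
    using y'(1) unfolding yy I_def sat_district_rows_iff by blast+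
  have feas': "feasible form X J y w"
    using str y0 y1 yC X bd[OF y0 y1] unfolding feasible_def structural_def by auto
  \<comment> \<open>The row \<open>x i e >= 0\<close> is tight at \<open>x\<close> and hence at the
    vertex. No district gains an edge of which it had no share, so a finite cost stays
    finite.\<close>
  have zero: "y i e = 0" if "i \<in> ?P" "e \<in> edges J" "x i e = 0" for i e
  proof -
    let ?r = "(\<lambda>v. if v = (i, e) then 1 else 0, 0) :: (nat \<times> nat set \<Rightarrow> real) \<times> real"
    have "?r \<in> district_rows X J w" using that by (auto simp: district_rows_def)
    then have "?r \<in> tight I (district_rows X J w) (\<lambda>(i, e). x i e)"
      using that lin_unit[of "(i, e)" J "\<lambda>(i, e). x i e"] by (simp add: tight_def I_def)
    then have "?r \<in> tight I (district_rows X J w) y'" using y'(3) by blast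
    then show ?thesis
      using that lin_unit[of "(i, e)" J y'] by (simp add: tight_def I_def y_def)
  qed
  have "objective \<alpha> X J y w \<le> objective \<alpha> X J x w"
  proof (rule objective_le[OF val str])
    assume "finite_cost \<alpha> J x w"
    then have "finite_cost \<alpha> J y w" using zero unfolding finite_cost_def by blast
    moreover have "real_cost \<alpha> J y w \<le> real_cost \<alpha> J x w"
      using y'(2) unfolding yy I_def lin_real_cost .
    ultimately show "finite_cost \<alpha> J y w \<and> real_cost \<alpha> J y w \<le> real_cost \<alpha> J x w" by blast
  qed
  moreover have "1 \<le> real (vertex_bound (ndist J) (card (edges J))) * y i e"
    if "i \<in> ?P" "e \<in> edges J" "y i e \<noteq> 0" for i e
  proof -
    have "(i, e) \<in> I" "0 \<le> y i e" using that y0 by (auto simp: I_def)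
    with low[of "(i, e)"] that(3) show ?thesis
      by (simp add: cardI y_def vertex_bound_def)
  qed
  ultimately show ?thesis using that feas' by blast
qed

text \<open>Applied twice: to the shares of an edge and to the costs they incur.\<close>

lemma sum_spread:
  fixes h h' :: "nat \<Rightarrow> real"
  assumes "finite P" "j \<in> P" "Z \<subseteq> P - {j}" "\<And>k. k \<in> Z \<Longrightarrow> h k = 0"
    and "\<And>k. k \<in> insert j Z \<Longrightarrow> h' k = h j / real (card Z + 1)"
    and "\<And>k. k \<in> P - insert j Z \<Longrightarrow> h' k = h k"
  shows "sum h' P = sum h P"
proof -
  have Z: "insert j Z \<subseteq> P" "finite Z" "j \<notin> Z" using assms(1-3) by (auto intro: finite_subset)
  have split: "sum g P = sum g (P - insert j Z) + sum g (insert j Z)" for g :: "nat \<Rightarrow> real"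
    using sum.subset_diff[OF Z(1) assms(1)] .
  have "sum h' (insert j Z) = (\<Sum>k\<in>insert j Z. h j / real (card Z + 1))"
    using assms(5) by (intro sum.cong refl)
  also have "\<dots> = h j"
    using Z by simp
  also have "\<dots> = sum h (insert j Z)"
    using Z assms(4) by simp
  finally have "sum h' (insert j Z) = sum h (insert j Z)" .
  moreover have "sum h' (P - insert j Z) = sum h (P - insert j Z)"
    using assms(6) by (rule sum.cong[OF refl])
  ultimately show ?thesis using split by metis
qed

text \<open>For a fixed center, the contiguity constraints of a district are convex and hold for the empty
  district, so a district may share its edges with empty ones placed at the same center.\<close>

lemma fractional_nonempty:
  assumes val: "valid_instance form X J"
    and X: "GrpN \<in> X" "GrpB \<notin> X" "GrpI \<notin> X"
    and feas: "feasible form X J x w"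
  shows "\<exists>x' w'. feasible form X J x' w' \<and> objective \<alpha> X J x' w' \<le> objective \<alpha> X J x w \<and>
    (\<forall>i\<in>{1..ndist J}. \<exists>e\<in>edges J.
       1 \<le> real (ndist J * vertex_bound (ndist J) (card (edges J))) * x' i e)"
proof -
  let ?P = "{1..ndist J}" and ?B = "real (vertex_bound (ndist J) (card (edges J)))"
  obtain y where y: "feasible form X J y w" "objective \<alpha> X J y w \<le> objective \<alpha> X J x w"
    and low: "\<And>i e. i \<in> ?P \<Longrightarrow> e \<in> edges J \<Longrightarrow> y i e \<noteq> 0 \<Longrightarrow> 1 \<le> ?B * y i e"
    using fractional_round[OF val X feas] by blast
  have str: "structural J y w" using y(1) by (simp add: feasible_def)
  then have y0: "\<forall>i\<in>?P. \<forall>e\<in>edges J. 0 \<le> y i e" and y1: "\<forall>e\<in>edges J. (\<Sum>i\<in>?P. y i e) = 1"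
    unfolding structural_def by blast+
  have w01: "w k v \<in> {0, 1}" if "k \<in> ?P" "v \<in> verts J" for k v
    using str that unfolding structural_def by blast
  have "edges J \<noteq> {}" using val by (auto simp: valid_instance_def)
  then obtain e0 where e0: "e0 \<in> edges J" by blast
  have "\<exists>j\<in>?P. y j e0 \<noteq> 0"
  proof (rule ccontr)
    assume "\<not> ?thesis"
    then have "(\<Sum>i\<in>?P. y i e0) = 0" by (intro sum.neutral) blast
    then show False using y1 e0 by simp
  qed
  then obtain j where j: "j \<in> ?P" "y j e0 \<noteq> 0" by blast
  define Z where "Z = {i \<in> ?P. \<forall>e\<in>edges J. y i e = 0}"
  have Z: "Z \<subseteq> ?P - {j}" using j e0 by (auto simp: Z_def)
  \<comment> \<open>The number of districts sharing the edges of \<open>j\<close>; it is at most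
    \<open>p\<close> because \<open>j\<close> itself is not in \<open>Z\<close>.\<close>
  define q where "q = real (card Z + 1)"
  have "card Z \<le> card (?P - {j})" using Z by (intro card_mono) auto
  then have "card Z + 1 \<le> ndist J" using j(1) by auto
  then have q: "1 \<le> q" "q \<le> real (ndist J)" unfolding q_def by linarith+
  define x' where "x' = (\<lambda>i e. if i \<in> insert j Z then y j e / q else y i e)"
  define w' where "w' = (\<lambda>i. if i \<in> insert j Z then w j else w i)"
  have x'0: "0 \<le> x' i e" if "i \<in> ?P" "e \<in> edges J" for i e
    using y0 that j(1) q(1) by (auto simp: x'_def)
  have x'1: "(\<Sum>i\<in>?P. x' i e) = 1" if "e \<in> edges J" for e
  proof -
    have "(\<Sum>i\<in>?P. x' i e) = (\<Sum>i\<in>?P. y i e)"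
      using that by (intro sum_spread[OF _ j(1) Z]) (auto simp: x'_def q_def Z_def)
    then show ?thesis using y1 that by simp
  qed
  have str': "structural J x' w'"
    using str x'0 x'1 j(1) unfolding structural_def w'_def by auto
  have "contiguous J x' w'" if C: "GrpC \<in> X"
    unfolding contiguous_def
  proof (intro allI impI ballI)
    fix D i assume D: "D \<subseteq> edges J \<and> D \<noteq> {}" and i: "i \<in> ?P"
    have cy: "contiguous J y w" using y(1) C by (simp add: feasible_def)
    show "1 \<le> (\<Sum>e\<in>boundary J D. x' i e) + (\<Sum>e\<in>D. 1 - x' i e) + (\<Sum>v\<in>\<Union>D. w' i v)"
    proof (cases "i \<in> insert j Z")
      case False
      then show ?thesis using cy D i by (simp add: contiguous_def x'_def w'_def)
    next
      case True
      let ?b = "\<Sum>e\<in>boundary J D. y j e" and ?s = "\<Sum>e\<in>D. y j e" and ?w = "\<Sum>v\<in>\<Union>D. w j v"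
      have finD: "finite D" using D finite_edges finite_subset by blast
      have "1 \<le> ?b + (\<Sum>e\<in>D. 1 - y j e) + ?w" using cy D j(1) by (simp add: contiguous_def)
      then have 1: "1 \<le> ?b + (real (card D) - ?s) + ?w" by (simp add: sum_subtractf)
      have "card D \<noteq> 0" using D finD by simp
      then have 2: "1 \<le> real (card D)" by simp
      have 3: "0 \<le> ?w"
      proof (rule sum_nonneg)
        fix v assume "v \<in> \<Union>D"
        then have "v \<in> verts J" using D edge_subset_verts(1)[OF val] by blast
        from w01[OF j(1) this] show "0 \<le> w j v" by auto
      qed
      \<comment> \<open>The goal is a convex combination: weight \<open>1 - 1/q\<close> on the
        inequality of an empty district centered like \<open>j\<close>, which holds as
        \<open>D\<close> is nonempty, and weight \<open>1/q\<close> on that of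
        \<open>j\<close>.\<close>
      have "0 \<le> (1 - 1 / q) * (real (card D) + ?w - 1)"
        using q(1) 2 3 by (intro mult_nonneg_nonneg) simp_all
      moreover have "0 \<le> (1 / q) * (?b + (real (card D) - ?s) + ?w - 1)"
        using q(1) 1 by (intro mult_nonneg_nonneg) simp_all
      ultimately have "1 \<le> ?b / q + (real (card D) - ?s / q) + ?w"
        by (simp add: algebra_simps diff_divide_distrib add_divide_distrib)
      then show ?thesis
        using True by (simp add: x'_def w'_def sum_subtractf sum_divide_distrib)
    qed
  qed
  moreover have "x' i e \<le> 1" if "i \<in> ?P" "e \<in> edges J" for i e
    using member_le_sum[of i ?P "\<lambda>i. x' i e"] x'0 x'1 that by auto
  ultimately have feas': "feasible form X J x' w'"
    using str' x'0 X unfolding feasible_def by auto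
  have "objective \<alpha> X J x' w' \<le> objective \<alpha> X J y w"
  proof (rule objective_le[OF val str], rule conjI)
    assume fin: "finite_cost \<alpha> J y w"
    show "finite_cost \<alpha> J x' w'"
      unfolding finite_cost_def
    proof (intro ballI impI)
      fix i v e assume *: "i \<in> ?P" "v \<in> verts J" "e \<in> edges J" "w' i v \<noteq> 0" "x' i e \<noteq> 0"
      then obtain k where "k \<in> ?P" "w k v \<noteq> 0" "y k e \<noteq> 0"
        using j(1) by (cases "i \<in> insert j Z") (auto simp: x'_def w'_def)
      then show "edge_dist \<alpha> J v e \<noteq> \<infinity>" using fin * by (auto simp: finite_cost_def)
    qed
    \<comment> \<open>The sharing districts have the center of \<open>j\<close> and thus its unit
      costs, so the cost of \<open>j\<close> is merely divided among them.\<close>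
    have "(\<Sum>i\<in>?P. unit_cost \<alpha> J w' i e * x' i e) = (\<Sum>i\<in>?P. unit_cost \<alpha> J w i e * y i e)"
      if "e \<in> edges J" for e
      using that by (intro sum_spread[OF _ j(1) Z]) (auto simp: x'_def w'_def unit_cost_def q_def Z_def)
    then show "real_cost \<alpha> J x' w' \<le> real_cost \<alpha> J y w"
      by (simp add: real_cost_def)
  qed
  moreover have "\<exists>e\<in>edges J. 1 \<le> real (ndist J * vertex_bound (ndist J) (card (edges J))) * x' i e"
    if i: "i \<in> ?P" for i
  proof -
    \<comment> \<open>Take \<open>k = j\<close> for a sharing district and \<open>k = i\<close>
      otherwise. Division by \<open>q <= p\<close> is the origin of the extra factor
      \<open>ndist J\<close>.\<close>
    have "\<exists>k\<in>?P. \<exists>e\<in>edges J. y k e \<noteq> 0 \<and> y k e / real (ndist J) \<le> x' i e"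
    proof (cases "i \<in> insert j Z")
      case True
      then have "y j e0 / real (ndist J) \<le> x' i e0"
        using q y0 j(1) e0 by (auto simp: x'_def intro!: divide_left_mono)
      then show ?thesis using j e0 by blast
    next
      case False
      then obtain e where e: "e \<in> edges J" "y i e \<noteq> 0" using i by (auto simp: Z_def)
      then have "y i e / real (ndist J) \<le> y i e / 1"
        using q y0 i by (intro divide_left_mono) auto
      then show ?thesis using False e i by (intro bexI[of _ i] bexI[of _ e]) (auto simp: x'_def)
    qed
    then obtain k e where k: "k \<in> ?P" "e \<in> edges J" "y k e \<noteq> 0" "y k e / real (ndist J) \<le> x' i e" by blast
    have "1 \<le> ?B * y k e" using low k by blast
    also have "\<dots> = real (ndist J) * ?B * (y k e / real (ndist J))"
      using q by simp
    also have "\<dots> \<le> real (ndist J) * ?B * x' i e"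
      using k(4) by (intro mult_left_mono) auto
    finally show ?thesis using k(2) by auto
  qed
  ultimately show ?thesis using feas' y(2) by (meson order_trans)
qed

section \<open>Encodings and size bounds\<close>

fun bin_value :: "sym list \<Rightarrow> nat" where
  "bin_value [] = 0"
| "bin_value (b # bs) = of_bool (b = One) + 2 * bin_value bs"

lemma bin_value_bin: "bin_value (bin n) = n"
proof (induction n rule: bin.induct)
  case (1 n)
  then show ?case
    by (subst bin.simps) (auto elim!: oddE)
qed

lemma Sep_notin_bin: "Sep \<notin> set (bin n)"
proof (induction n rule: bin.induct)
  case (1 n)
  then show ?case by (subst bin.simps) auto
qed

lemma bin_double: "0 < n \<Longrightarrow> bin (2 * n) = Zero # bin n"
  by (subst bin.simps) simp

lemma bin_1: "bin 1 = [One]"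
  by (simp add: bin.simps)

lemma bin_power2: "bin (2 ^ k) = replicate k Zero @ [One]"
  by (induction k) (simp_all add: bin_double bin_1[unfolded One_nat_def])

lemma less_power_bin: "n < 2 ^ length (bin n)"
proof (induction n rule: bin.induct)
  case (1 n)
  show ?case
  proof (cases "n = 0")
    case False
    have "n < 2 * (n div 2 + 1)" by simp
    also have "\<dots> \<le> 2 * 2 ^ length (bin (n div 2))" using 1[OF False] by simp
    also have "\<dots> = 2 ^ length (bin n)" using False by (subst (2) bin.simps) simp
    finally show ?thesis .
  qed simp
qed

lemma code_simps: "code [] = []" "code (n # ns) = bin n @ Sep # code ns" "code (ms @ ns) = code ms @ code ns"
  by (simp_all add: code_def)

text \<open>\<open>Sep\<close> never occurs inside a number, so the first one ends the first
  number.\<close>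

lemma code_inject: "code ms = code ns \<longleftrightarrow> ms = ns"
proof
  assume "code ms = code ns"
  then show "ms = ns"
  proof (induction ms arbitrary: ns)
    case Nil
    then show ?case by (cases ns) (auto simp: code_simps)
  next
    case (Cons m ms)
    then obtain n ns' where ns: "ns = n # ns'" by (cases ns) (auto simp: code_simps)
    have eq: "bin m @ Sep # code ms = bin n @ Sep # code ns'"
      using Cons.prems by (simp add: ns code_simps)
    have tw: "takeWhile (\<lambda>s. s \<noteq> Sep) (bin k @ Sep # r) = bin k" for k r
      using Sep_notin_bin[of k] by (subst takeWhile_append2) auto
    have "bin m = bin n" using tw eq by metis
    with eq have "m = n" "code ms = code ns'" by (metis bin_value_bin, simp)
    with Cons.IH ns show ?case by blast
  qed
qed simp

lemma length_code: "length ns \<le> length (code ns)"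
  by (induction ns) (simp_all add: code_simps)

lemma less_power_code: "n \<in> set ns \<Longrightarrow> n < 2 ^ length (code ns)"
proof (induction ns)
  case (Cons m ns)
  have "2 ^ length (bin m) \<le> (2 ^ length (code (m # ns)) :: nat)"
    "2 ^ length (code ns) \<le> (2 ^ length (code (m # ns)) :: nat)"
    by (intro power_increasing; simp add: code_simps)+
  with Cons less_power_bin[of m] show ?case by (auto intro: less_le_trans)
qed simp

lemma enc_rat_of_int_div:
  assumes "0 < b" "coprime a b"
  shows "enc_rat (of_int a / of_int b) = [nat a, nat b]"
  using assms by (simp add: enc_rat_def Fract_of_int_quotient[symmetric] quotient_of_Fract normalize_stable)

text \<open>\<open>nat\<close> sends negative numerators to 0; a positive numerator on one side
  excludes this on the other.\<close>

lemma enc_rat_inject: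
  assumes "0 < s" "enc_rat t = enc_rat s"
  shows "t = s"
proof -
  obtain a b where s: "quotient_of s = (a, b)" by fastforce
  obtain c d where t: "quotient_of t = (c, d)" by fastforce
  have pos: "0 < b" "0 < d" using quotient_of_denom_pos[OF s] quotient_of_denom_pos[OF t] by auto
  have "0 < a"
    using assms(1) pos(1) quotient_of_div[OF s] by (simp add: zero_less_divide_iff)
  then have "a = c" "b = d" using assms(2) s t pos by (auto simp: enc_rat_def)
  then show ?thesis using quotient_of_div[OF s] quotient_of_div[OF t] by simp
qed

text \<open>Numerator and denominator both lie between 1 and \<open>N\<close>.\<close>

lemma quotient_of_bounds:
  assumes "0 < r" "\<And>n. n \<in> set (enc_rat r) \<Longrightarrow> n \<le> N"
  shows "(of_rat r :: real) \<le> real N" "1 \<le> of_rat r * real N"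
proof -
  obtain a b where r: "quotient_of r = (a, b)" by fastforce
  have b: "0 < b" using quotient_of_denom_pos[OF r] .
  have a: "0 < a"
    using assms(1) b quotient_of_div[OF r] by (simp add: zero_less_divide_iff)
  have N: "nat a \<le> N" "nat b \<le> N" using assms(2) by (simp_all add: enc_rat_def r)
  then have N': "real_of_int a \<le> real N" "real_of_int b \<le> real N" using a b by linarith+
  have eq: "(of_rat r :: real) = of_int a / of_int b"
    using quotient_of_div[OF r] by (simp add: of_rat_divide)
  have ge: "1 \<le> real_of_int a" "1 \<le> real_of_int b" using a b by simp_all
  have "real_of_int a \<le> real N * real_of_int b" using N'(1) ge mult_mono[of "real_of_int a" "real N" 1 "real_of_int b"] by simp
  then show "(of_rat r :: real) \<le> real N" using b by (simp add: eq divide_le_eq)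
  have "real_of_int b \<le> real_of_int a * real N" using N'(2) ge mult_mono[of 1 "real_of_int a" "real_of_int b" "real N"] by simp
  then show "1 \<le> of_rat r * real N" using b by (simp add: eq le_divide_eq)
qed

text \<open>\<open>enc_instance\<close> puts the tolerance last, so adding one means appending to
  the string.\<close>

definition instance_numbers :: "districting \<Rightarrow> nat list" where
  "instance_numbers J = [length (vertex_list J), length (edge_list J), ndist J] @ vertex_list J @
      concat (map (\<lambda>(u, v, r). [u, v] @ enc_rat r) (edge_list J)) @ centers J"

lemma enc_instance_None: "tol J = None \<Longrightarrow> enc_instance J = code (instance_numbers J)"
  by (simp add: enc_instance_def instance_numbers_def)

lemma enc_instance_Some: "tol J = Some t \<Longrightarrow> enc_instance J = code (instance_numbers J @ enc_rat t)"
  by (simp add: enc_instance_def instance_numbers_def)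

lemma instance_numbers_tol: "instance_numbers (J\<lparr>tol := t\<rparr>) = instance_numbers J"
  by (simp add: instance_numbers_def)

lemma length_enc_rat: "length (enc_rat r) = 2"
  by (simp add: enc_rat_def)

text \<open>An answer refers to some instance with the given code. Since a rational always takes two
  numbers, the tolerance can be split off at the end of that code.\<close>

lemma enc_instance_append_tol:
  assumes "tol J = None" "tol J' = Some t" "0 < s"
    and "enc_instance J' = enc_instance J @ code (enc_rat s)"
  shows "t = s" "instance_numbers J' = instance_numbers J"
proof -
  have "instance_numbers J' @ enc_rat t = instance_numbers J @ enc_rat s"
    using assms by (simp add: enc_instance_None enc_instance_Some code_simps(3)[symmetric] code_inject del: code_simps)
  then have "instance_numbers J' = instance_numbers J \<and> enc_rat t = enc_rat s"
    by (simp add: append_eq_append_conv length_enc_rat)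
  then show "t = s" "instance_numbers J' = instance_numbers J"
    using enc_rat_inject[OF assms(3)] by blast+
qed

section \<open>Bounds in terms of the input length\<close>

lemma card_edges:
  assumes "valid_instance form X J"
  shows "card (edges J) = length (edge_list J)"
  using assms distinct_card[of "edge_order J"] by (simp add: valid_instance_def edges_def edge_order_def)

text \<open>Four numbers per edge and three in the header, each with at least its separator.\<close>

lemma card_edges_le_enc:
  assumes "valid_instance form X J" "tol J = None"
  shows "4 * card (edges J) + 3 \<le> length (enc_instance J)"
proof -
  have "length (concat (map (\<lambda>(u, v, r). [u, v] @ enc_rat r) es)) = 4 * length es" for es :: "(nat \<times> nat \<times> rat) list"
    by (induction es) (auto simp: length_enc_rat)
  then have "4 * length (edge_list J) + 3 \<le> length (instance_numbers J)"
    by (simp add: instance_numbers_def)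
  also have "\<dots> \<le> length (enc_instance J)"
    by (simp add: enc_instance_None[OF assms(2)] length_code)
  finally show ?thesis by (simp add: card_edges[OF assms(1)])
qed

lemma weight_enc_bounds:
  assumes "valid_instance form X J" "tol J = None" "e \<in> edges J"
  shows "weight J e \<le> 2 ^ length (enc_instance J)" "1 \<le> weight J e * 2 ^ length (enc_instance J)"
proof -
  obtain u v r where uvr: "(u, v, r) \<in> set (edge_list J)" "r > 0" "weight J e = of_rat r"
    using edgeE[OF assms(1,3)] by metis
  then have "set (enc_rat r) \<subseteq> set (instance_numbers J)"
    by (force simp: instance_numbers_def)
  then have "n \<le> 2 ^ length (enc_instance J)" if "n \<in> set (enc_rat r)" for n
    using less_power_code[of n "instance_numbers J"] that by (force simp: enc_instance_None[OF assms(2)])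
  from quotient_of_bounds[OF uvr(2) this] show "weight J e \<le> 2 ^ length (enc_instance J)" "1 \<le> weight J e * 2 ^ length (enc_instance J)"
    by (simp_all add: uvr(3))
qed

text \<open>Factorial and power both have \<open>p m <= m^2\<close> factors, at most
  \<open>2^(2 m)\<close> each in the former and \<open>2^(4 m)\<close> in the latter.\<close>

lemma vertex_bound_le:
  assumes "1 \<le> p" "p \<le> m"
  shows "vertex_bound p m \<le> 2 ^ (6 * m ^ 3)"
proof -
  have m: "m \<le> 2 ^ m" "p \<le> 2 ^ m"
    using less_exp[of m] assms(2) by linarith+
  have pm: "p * m \<le> 2 ^ (2 * m)"
    using mult_mono[OF m(2,1)] by (simp add: mult_2 power_add)
  have pmm: "p * m \<le> m * m" using assms by simp
  have "(fact (p * m) :: nat) \<le> (p * m) ^ (p * m)" using fact_le_power[of "p * m", where 'a = nat] by simp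
  also have "\<dots> \<le> (2 ^ (2 * m)) ^ (p * m)" using pm by (rule power_mono) simp
  also have "\<dots> \<le> (2 ^ (2 * m)) ^ (m * m)" using pmm by (intro power_increasing) simp_all
  finally have 1: "fact (p * m) \<le> ((2::nat) ^ (2 * m)) ^ (m * m)" .
  have "2 * m \<le> 2 * 2 ^ m" using m by simp
  also have "\<dots> \<le> 2 ^ m * 2 ^ m"
    using assms power_increasing[of 1 m "2::nat"] by (intro mult_right_mono) simp_all
  finally have "2 * m \<le> 2 ^ (2 * m)" by (simp add: mult_2 power_add)
  moreover have "p * 2 ^ m \<le> 2 ^ (2 * m)"
    using m(2) by (simp add: mult_2 power_add)
  ultimately have "p * m + 2 * m + p * 2 ^ m \<le> 4 * 2 ^ (2 * m)"
    using pm by linarith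
  also have "\<dots> = 2 ^ (2 * m + 2)" by simp
  also have "\<dots> \<le> 2 ^ (4 * m)" using assms by (intro power_increasing) simp_all
  finally have "(p * m + 2 * m + p * 2 ^ m) ^ (p * m) \<le> (2 ^ (4 * m)) ^ (p * m)"
    by (rule power_mono) simp
  also have "\<dots> \<le> (2 ^ (4 * m)) ^ (m * m)" using pmm by (intro power_increasing) simp_all
  finally have 2: "(p * m + 2 * m + p * 2 ^ m) ^ (p * m) \<le> (2 ^ (4 * m)) ^ (m * m)" .
  have "vertex_bound p m \<le> (2 ^ (2 * m)) ^ (m * m) * (2 ^ (4 * m)) ^ (m * m)"
    unfolding vertex_bound_def using 1 2 by (rule mult_mono) simp_all
  also have "\<dots> = 2 ^ (6 * m ^ 3)"
    by (simp add: power_mult[symmetric] power_add[symmetric] power3_eq_cube algebra_simps)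
  finally show ?thesis .
qed

text \<open>The product collects the total weight (at most \<open>m 2^L\<close>), the reciprocal of
  the least weight (at most \<open>2^L\<close>) and the Cramer bound. From
  \<open>L >= 4 m + 3 >= 7\<close> follow \<open>64 m^3 <= L^3\<close> and
  \<open>49 L <= L^3\<close>, which leave room for the exponent \<open>3 L + 6 m^3\<close>.\<close>

lemma padding_exponent:
  assumes "1 \<le> p" "p \<le> m" "4 * m + 3 \<le> L"
  shows "m * 2 ^ L * 2 ^ L * vertex_bound p m \<le> 2 ^ (L ^ 3)" "p \<le> 2 ^ (L ^ 3)"
proof -
  have "(4 * m) ^ 3 \<le> L ^ 3" using assms by (intro power_mono) simp_all
  then have 1: "64 * m ^ 3 \<le> L ^ 3" by (simp add: power_mult_distrib)
  have "7 * 7 * L \<le> L * L * L" using assms by (intro mult_mono) simp_all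
  then have 2: "49 * L \<le> L ^ 3" by (simp add: power3_eq_cube)
  have mL: "m \<le> 2 ^ L" using less_exp[of L] assms by linarith
  have "m * 2 ^ L * 2 ^ L * vertex_bound p m \<le> 2 ^ L * 2 ^ L * 2 ^ L * 2 ^ (6 * m ^ 3)"
    using mL vertex_bound_le[OF assms(1,2)] by (intro mult_mono) simp_all
  also have "\<dots> = 2 ^ (3 * L + 6 * m ^ 3)"
    by (simp add: power_add[symmetric])
  also have "\<dots> \<le> 2 ^ (L ^ 3)"
    using 1 2 by (intro power_increasing) simp_all
  finally show "m * 2 ^ L * 2 ^ L * vertex_bound p m \<le> 2 ^ (L ^ 3)" .
  have "L \<le> L ^ 3" using 2 by simp
  then show "p \<le> 2 ^ (L ^ 3)" using less_exp[of "L ^ 3"] assms by linarith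
qed

section \<open>The reduction\<close>

text \<open>Any \<open>\<tau>\<close> beyond a threshold makes the balance constraints harmless. The threshold is exponential
  in the size of the instance, but the exponent is at most cubic.\<close>

definition lax_tol :: "bound_form \<Rightarrow> nat \<Rightarrow> rat" where
  "lax_tol form K = (case form of Additive \<Rightarrow> 2 ^ K | Multiplicative \<Rightarrow> 1 / 2 ^ K)"

lemma lax_tol_pos: "0 < lax_tol form K"
  by (simp add: lax_tol_def split: bound_form.split)

text \<open>With the least significant bit first, \<open>2 ^ K\<close> is \<open>K\<close> zeros and
  a one; only the zeros depend on \<open>K\<close>.\<close>

lemma code_lax_tol:
  obtains pre suf where "\<And>K. code (enc_rat (lax_tol form K)) = pre @ replicate K Zero @ suf"
proof (cases form)
  case Additive
  have "enc_rat (lax_tol form K) = [2 ^ K, 1]" for K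
    using enc_rat_of_int_div[of 1 "2 ^ K"] Additive by (simp add: lax_tol_def nat_power_eq)
  then show ?thesis
    using that[of "[]" "[One, Sep, One, Sep]"] by (simp add: code_simps bin_power2 bin_1[unfolded One_nat_def])
next
  case Multiplicative
  have "enc_rat (lax_tol form K) = [1, 2 ^ K]" for K
    using enc_rat_of_int_div[of "2 ^ K" 1] Multiplicative by (simp add: lax_tol_def nat_power_eq)
  then show ?thesis
    using that[of "[One, Sep]" "[One, Sep]"] by (simp add: code_simps bin_power2 bin_1[unfolded One_nat_def])
qed

section \<open>Changing the tolerance of an instance\<close>

lemma tol_update_graph [simp]:
  "verts (J\<lparr>tol := t\<rparr>) = verts J" "edge_order (J\<lparr>tol := t\<rparr>) = edge_order J"
  "edges (J\<lparr>tol := t\<rparr>) = edges J" "weight (J\<lparr>tol := t\<rparr>) = weight J"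
  by (simp_all add: fun_eq_iff verts_def edge_order_def edges_def weight_def)

lemma tol_update_derived [simp]:
  "mean_weight (J\<lparr>tol := t\<rparr>) = mean_weight J" "boundary (J\<lparr>tol := t\<rparr>) = boundary J"
  "sp_dist (J\<lparr>tol := t\<rparr>) = sp_dist J" "structural (J\<lparr>tol := t\<rparr>) = structural J"
  "enc_solution (J\<lparr>tol := t\<rparr>) = enc_solution J"
  by (simp_all add: fun_eq_iff mean_weight_def boundary_def sp_dist_def structural_def enc_solution_def)

lemma tol_update_contiguous [simp]: "contiguous (J\<lparr>tol := t\<rparr>) = contiguous J"
  by (simp add: fun_eq_iff contiguous_def)

lemma tol_update_objective [simp]: "objective \<alpha> X (J\<lparr>tol := t\<rparr>) = objective \<alpha> X J"
  by (simp add: fun_eq_iff objective_def edge_dist_def)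

lemma objective_insert_B: "objective \<alpha> (insert GrpB X) J = objective \<alpha> X J"
  by (simp add: objective_def fun_eq_iff)

lemma feasible_insert_B:
  assumes "GrpB \<notin> X" "GrpN \<in> X"
  shows "feasible form (insert GrpB X) (J\<lparr>tol := t\<rparr>) x w \<longleftrightarrow>
    feasible form X J x w \<and> balanced form (J\<lparr>tol := t\<rparr>) x"
  using assms by (auto simp: feasible_def)

lemma valid_insert_B:
  assumes "GrpB \<notin> X" "GrpN \<in> X"
  shows "valid_instance form (insert GrpB X) (J\<lparr>tol := Some t\<rparr>) \<longleftrightarrow>
    valid_instance form X (J\<lparr>tol := None\<rparr>) \<and>
    (case form of Additive \<Rightarrow> 0 \<le> t | Multiplicative \<Rightarrow> 0 < t \<and> t \<le> 1)"
  using assms by (auto simp: valid_instance_def)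

lemma valid_lax_tol:
  "case form of Additive \<Rightarrow> 0 \<le> lax_tol form K | Multiplicative \<Rightarrow> 0 < lax_tol form K \<and> lax_tol form K \<le> 1"
  by (simp add: lax_tol_def split: bound_form.split)

text \<open>Every district weighs between 0 and the total \<open>T\<close>. In both forms
  \<open>2 ^ K >= p\<close> lifts the upper bound to \<open>T\<close>. The additive lower bound is
  at most 0; the multiplicative one is positive and rests on \<open>heavy\<close>.\<close>

lemma lax_balanced:
  fixes x :: assignment
  assumes val: "valid_instance form X J" "tol J = None"
    and x: "\<And>i e. i \<in> {1..ndist J} \<Longrightarrow> e \<in> edges J \<Longrightarrow> 0 \<le> x i e \<and> x i e \<le> 1"
    and heavy: "\<And>i. form = Multiplicative \<Longrightarrow> i \<in> {1..ndist J} \<Longrightarrow> \<exists>e\<in>edges J.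
       1 \<le> real (ndist J * vertex_bound (ndist J) (card (edges J))) * x i e"
  shows "balanced form (J\<lparr>tol := Some (lax_tol form (length (enc_instance J) ^ 3))\<rparr>) x"
proof -
  define L where "L = length (enc_instance J)"
  define p where "p = ndist J"
  define m where "m = card (edges J)"
  define T where "T = (\<Sum>e\<in>edges J. weight J e)"
  have pm: "1 \<le> p" "p \<le> m" using val(1) by (simp_all add: valid_instance_def p_def m_def)
  have mean: "mean_weight J = T / real p" by (simp add: mean_weight_def T_def p_def)
  note exps = padding_exponent[OF pm card_edges_le_enc[OF val, folded m_def L_def]]
  have pK: "real p \<le> 2 ^ (L ^ 3)" using exps(2) by (metis of_nat_le_iff of_nat_numeral of_nat_power)
  have wpos: "0 < weight J e" if "e \<in> edges J" for e using weight_pos[OF val(1) that] .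
  have T0: "0 \<le> T" unfolding T_def using wpos by (intro sum_nonneg) (simp add: less_imp_le)
  have nonneg: "0 \<le> (\<Sum>e\<in>edges J. weight J e * x i e)" if "i \<in> {1..ndist J}" for i
    using wpos x[OF that] by (intro sum_nonneg mult_nonneg_nonneg) (auto simp: less_imp_le)
  have le_T: "(\<Sum>e\<in>edges J. weight J e * x i e) \<le> T" if "i \<in> {1..ndist J}" for i
    unfolding T_def using wpos x[OF that] by (intro sum_mono mult_left_le) (auto simp: less_imp_le)
  have T_up: "T \<le> T / real p * 2 ^ (L ^ 3)"
    using mult_left_mono[OF pK T0] pm by (simp add: field_simps)
  let ?J = "J\<lparr>tol := Some (lax_tol form (length (enc_instance J) ^ 3))\<rparr>"
  show ?thesis
  proof (cases form)
    case Additive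
    have lb: "lower_bound form ?J = (1 - 2 ^ (L ^ 3)) * (T / real p)"
      and ub: "upper_bound form ?J = (1 + 2 ^ (L ^ 3)) * (T / real p)"
      by (simp_all add: Additive lower_bound_def upper_bound_def mean lax_tol_def L_def of_rat_power)
    have "1 \<le> (2::real) ^ (L ^ 3)" by simp
    then have "(1 - 2 ^ (L ^ 3)) * (T / real p) \<le> 0"
      using T0 by (intro mult_nonpos_nonneg) simp_all
    moreover have "T \<le> (1 + 2 ^ (L ^ 3)) * (T / real p)"
    proof -
      have "0 \<le> T / real p" using T0 by simp
      moreover have "(1 + 2 ^ (L ^ 3)) * (T / real p) = T / real p + T / real p * 2 ^ (L ^ 3)"
        by (simp only: distrib_right mult_1_left mult.commute[of "T / real p"])
      ultimately show ?thesis using T_up by linarith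
    qed
    ultimately show ?thesis
      unfolding balanced_def lb ub tol_update_graph using nonneg le_T by (fastforce intro: order_trans)
  next
    case Multiplicative
    have lb: "lower_bound form ?J = T / real p / 2 ^ (L ^ 3)"
      and ub: "upper_bound form ?J = T / real p * 2 ^ (L ^ 3)"
      by (simp_all add: Multiplicative lower_bound_def upper_bound_def mean lax_tol_def L_def of_rat_power of_rat_divide)
    have "T / real p / 2 ^ (L ^ 3) \<le> (\<Sum>e\<in>edges J. weight J e * x i e)" if i: "i \<in> {1..ndist J}" for i
    proof -
      let ?V = "real (vertex_bound p m)"
      obtain e where e: "e \<in> edges J" "1 \<le> real p * ?V * x i e"
        using heavy[OF Multiplicative i] by (auto simp: p_def m_def)
      have "T \<le> (\<Sum>e\<in>edges J. 2 ^ L)"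
        unfolding T_def L_def using weight_enc_bounds(1)[OF val] by (intro sum_mono)
      then have TL: "T \<le> real m * 2 ^ L" by (simp add: m_def)
      have V: "real m * 2 ^ L * 2 ^ L * ?V \<le> 2 ^ (L ^ 3)"
        using exps(1) of_nat_le_iff[of "m * 2 ^ L * 2 ^ L * vertex_bound p m" "2 ^ (L ^ 3)", where 'a = real]
        by simp
      have bL: "1 \<le> weight J e * 2 ^ L"
        unfolding L_def by (rule weight_enc_bounds(2)[OF val e(1)])
      have xe: "0 \<le> x i e" using x[OF i e(1)] by simp
      \<comment> \<open>\<open>T\<close> is multiplied by two quantities that are at least 1, one
        from the share of \<open>e\<close> and one from its weight; then everything except
        \<open>p\<close> times the weight of that share is absorbed into
        \<open>2 ^ (L ^ 3)\<close>.\<close>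
      have "T = T * 1" by simp
      also have "\<dots> \<le> T * (real p * ?V * x i e)"
        using e(2) T0 by (rule mult_left_mono)
      also have "\<dots> = T * (1 * (real p * ?V * x i e))" by simp
      also have "\<dots> \<le> T * ((weight J e * 2 ^ L) * (real p * ?V * x i e))"
        using bL T0 xe by (intro mult_left_mono mult_right_mono) simp_all
      also have "\<dots> \<le> (real m * 2 ^ L) * ((weight J e * 2 ^ L) * (real p * ?V * x i e))"
        using TL wpos[OF e(1)] xe by (intro mult_right_mono) simp_all
      also have "\<dots> = (real m * 2 ^ L * 2 ^ L * ?V) * (real p * (weight J e * x i e))"
        by (simp add: mult_ac)
      also have "\<dots> \<le> 2 ^ (L ^ 3) * (real p * (weight J e * x i e))"
        using V wpos[OF e(1)] xe by (intro mult_right_mono) simp_all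
      finally have "T / real p / 2 ^ (L ^ 3) \<le> weight J e * x i e"
        using pm by (simp add: field_simps)
      also have "\<dots> \<le> (\<Sum>e\<in>edges J. weight J e * x i e)"
        using wpos x[OF i] by (intro member_le_sum[OF e(1)] finite_edges) (simp add: less_imp_le)
      finally show ?thesis .
    qed
    then show ?thesis
      unfolding balanced_def lb ub tol_update_graph using le_T T_up by (fastforce intro: order_trans)
  qed
qed

text \<open>Balanced solutions are feasible without the balance group as well, so this makes the two
  instances feasible together and their optimal values equal.\<close>

lemma lax_dominates:
  assumes X: "GrpB \<notin> X" "GrpN \<in> X"
    and val: "valid_instance form X J" and feas: "feasible form X J x w"
  shows "\<exists>x' w'. feasible form (insert GrpB X) (J\<lparr>tol := Some (lax_tol form (length (enc_instance J) ^ 3))\<rparr>) x' w' \<and>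
    objective \<alpha> X J x' w' \<le> objective \<alpha> X J x w"
proof -
  have tol: "tol J = None" using val X(1) by (simp add: valid_instance_def)
  let ?V = "real (ndist J * vertex_bound (ndist J) (card (edges J)))"
  have V: "1 \<le> ?V"
  proof -
    have "1 \<le> ndist J" using val by (simp add: valid_instance_def)
    moreover from this have "1 \<le> ndist J * 2 ^ card (edges J)" by simp
    then have "1 \<le> vertex_bound (ndist J) (card (edges J))"
      unfolding vertex_bound_def by (metis fact_ge_1 mult_le_mono nat_mult_1 one_le_power trans_le_add2)
    ultimately have "1 \<le> ndist J * vertex_bound (ndist J) (card (edges J))" by simp
    then show ?thesis by linarith
  qed
  have "\<exists>x' w'. feasible form X J x' w' \<and> objective \<alpha> X J x' w' \<le> objective \<alpha> X J x w \<and>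
    (\<forall>i\<in>{1..ndist J}. \<exists>e\<in>edges J. 1 \<le> ?V * x' i e)"
  proof (cases "GrpI \<in> X")
    case True
    from integral_nonempty[OF val X(2,1) True feas] obtain x' w' where
      *: "feasible form X J x' w'" "objective \<alpha> X J x' w' \<le> objective \<alpha> X J x w"
      "\<forall>i\<in>{1..ndist J}. \<exists>e\<in>edges J. x' i e = 1" by blast
    have "\<exists>e\<in>edges J. 1 \<le> ?V * x' i e" if i: "i \<in> {1..ndist J}" for i
    proof -
      obtain e where "e \<in> edges J" "x' i e = 1" using *(3) i by blast
      then show ?thesis using V by (intro bexI[of _ e]) simp_all
    qed
    then show ?thesis using * by blast
  next
    case False
    then show ?thesis using fractional_nonempty[OF val X(2,1) _ feas] by blast
  qed
  then obtain x' w' where *: "feasible form X J x' w'" "objective \<alpha> X J x' w' \<le> objective \<alpha> X J x w"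
    "\<forall>i\<in>{1..ndist J}. \<exists>e\<in>edges J. 1 \<le> ?V * x' i e" by blast
  have "0 \<le> x' i e \<and> x' i e \<le> 1" if "i \<in> {1..ndist J}" "e \<in> edges J" for i e
  proof -
    have "x' i e \<in> (if GrpI \<in> X then {0, 1} else {0..1})"
      using *(1) that unfolding feasible_def by blast
    then show ?thesis by (auto split: if_splits)
  qed
  then have "balanced form (J\<lparr>tol := Some (lax_tol form (length (enc_instance J) ^ 3))\<rparr>) x'"
    using *(3) by (intro lax_balanced[OF val tol]) blast+
  then show ?thesis using * feasible_insert_B[OF X] by blast
qed

lemma theta_reducible_refl: "theta form \<alpha> X \<le>\<^sub>P theta form \<alpha> X"
  unfolding poly_reducible_def
  using polytime_nth[of 0] polytime_nth[of 1]
  by (intro exI[of _ "\<lambda>xs. xs ! 0"] exI[of _ "\<lambda>xs. xs ! 1"]) (simp add: numeral_2_eq_2)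

lemma theta_reducible_insert_B:
  assumes X: "GrpB \<notin> X" "GrpN \<in> X"
  shows "theta form \<alpha> X \<le>\<^sub>P theta form \<alpha> (insert GrpB X)"
proof -
  obtain pre suf where pad: "\<And>K. code (enc_rat (lax_tol form K)) = pre @ replicate K Zero @ suf"
    using code_lax_tol by blast
  define F where "F xs = xs ! 0 @ pre @ replicate (length (xs ! 0) ^ 3) Zero @ suf" for xs :: "sym list list"
  have F: "F [s] = s @ code (enc_rat (lax_tol form (length s ^ 3)))" for s
    by (simp add: F_def pad)
  have "polytime 1 F" unfolding F_def by (rule polytime_pad)
  moreover have "polytime 2 (\<lambda>xs. xs ! 1)" using polytime_nth[of 1] by (simp add: numeral_2_eq_2)
  moreover have "F [s] \<in> instances (theta form \<alpha> (insert GrpB X)) \<and>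
      (\<forall>y \<in> answers (theta form \<alpha> (insert GrpB X)) (F [s]). [s, y] ! 1 \<in> answers (theta form \<alpha> X) s)"
    if s_inst: "s \<in> instances (theta form \<alpha> X)" for s
  proof
    define t where "t = lax_tol form (length s ^ 3)"
    obtain J where J: "valid_instance form X J" "s = enc_instance J"
      using s_inst by (auto simp: theta_def)
    have tol: "tol J = None" using J(1) X(1) by (simp add: valid_instance_def)
    have "F [s] = enc_instance (J\<lparr>tol := Some t\<rparr>)"
      by (simp add: F J(2) t_def enc_instance_None[OF tol] enc_instance_Some instance_numbers_tol code_simps)
    moreover have "J\<lparr>tol := None\<rparr> = J" using tol by simp
    then have "valid_instance form (insert GrpB X) (J\<lparr>tol := Some t\<rparr>)"
      using valid_insert_B[OF X] J(1) valid_lax_tol unfolding t_def by metis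
    ultimately show "F [s] \<in> instances (theta form \<alpha> (insert GrpB X))"
      by (auto simp: theta_def)
    show "\<forall>y \<in> answers (theta form \<alpha> (insert GrpB X)) (F [s]). [s, y] ! 1 \<in> answers (theta form \<alpha> X) s"
    proof
      fix y assume "y \<in> answers (theta form \<alpha> (insert GrpB X)) (F [s])"
      then obtain J' where J': "valid_instance form (insert GrpB X) J'" "F [s] = enc_instance J'"
        and y: "(\<exists>x w. optimal form \<alpha> (insert GrpB X) J' (\<lambda>i e. of_rat (x i e)) (\<lambda>i v. of_rat (w i v)) \<and>
            y = enc_solution J' x w) \<or>
          (\<not> (\<exists>x w. feasible form (insert GrpB X) J' x w) \<and> y = enc_infeasible)"
        by (auto simp: theta_def)
      \<comment> \<open>\<open>J'\<close> is only known to share its code with the translated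
        instance. Without its tolerance it has code \<open>s\<close>, so the answer is justified for
        \<open>J0\<close> instead of \<open>J\<close>.\<close>
      define J0 where "J0 = J'\<lparr>tol := None\<rparr>"
      obtain t' where t': "tol J' = Some t'" using J'(1) by (auto simp: valid_instance_def)
      have "t' = t" and nums: "instance_numbers J' = instance_numbers J"
        using enc_instance_append_tol[OF tol t', of t] J'(2) J(2) lax_tol_pos by (auto simp: F t_def)
      then have J'_eq: "J' = J0\<lparr>tol := Some t\<rparr>" using t' by (simp add: J0_def)
      have s: "s = enc_instance J0"
        using nums tol by (simp add: J(2) J0_def enc_instance_None instance_numbers_tol)
      have val: "valid_instance form X J0"
        using J'(1) valid_insert_B[OF X] unfolding J'_eq by (simp add: J0_def)
      note feas_iff = feasible_insert_B[OF X, where J = J0 and t = "Some t" and form = form, folded J'_eq]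
      \<comment> \<open>This ranges over real solutions, as optimality and infeasibility do,
        although answers are rational. As \<open>J0\<close> has code \<open>s\<close>, its exponent
        is the one used by \<open>F\<close>.\<close>
      have dom: "\<exists>x' w'. feasible form (insert GrpB X) J' x' w' \<and> objective \<alpha> X J0 x' w' \<le> objective \<alpha> X J0 x w"
        if "feasible form X J0 x w" for x w
        using lax_dominates[OF X val that] unfolding s[symmetric] t_def[symmetric] J'_eq .
      have obj: "objective \<alpha> (insert GrpB X) J' = objective \<alpha> X J0"
        by (simp add: J'_eq objective_insert_B)
      have opt: "optimal form \<alpha> X J0 x w" if "optimal form \<alpha> (insert GrpB X) J' x w" for x w
        unfolding optimal_def
      proof (intro conjI allI impI)
        show "feasible form X J0 x w" using that feas_iff by (simp add: optimal_def)
        fix x' w' assume "feasible form X J0 x' w'"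
        from dom[OF this] obtain x'' w'' where
          *: "feasible form (insert GrpB X) J' x'' w''" "objective \<alpha> X J0 x'' w'' \<le> objective \<alpha> X J0 x' w'"
          by blast
        from that *(1) have "objective \<alpha> X J0 x w \<le> objective \<alpha> X J0 x'' w''"
          unfolding optimal_def obj by blast
        from this *(2) show "objective \<alpha> X J0 x w \<le> objective \<alpha> X J0 x' w'" by (rule order_trans)
      qed
      have sol: "enc_solution J' = enc_solution J0" by (simp add: J'_eq)
      from y have "(\<exists>x w. optimal form \<alpha> X J0 (\<lambda>i e. of_rat (x i e)) (\<lambda>i v. of_rat (w i v)) \<and>
            y = enc_solution J0 x w) \<or>
          (\<not> (\<exists>x w. feasible form X J0 x w) \<and> y = enc_infeasible)"
      proof (elim disjE exE conjE)
        fix x w assume "optimal form \<alpha> (insert GrpB X) J' (\<lambda>i e. of_rat (x i e)) (\<lambda>i v. of_rat (w i v))"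
          "y = enc_solution J' x w"
        with opt sol show ?thesis by (intro disjI1 exI[of _ x] exI[of _ w]) simp
      next
        assume none: "\<not> (\<exists>x w. feasible form (insert GrpB X) J' x w)" and "y = enc_infeasible"
        moreover have "\<not> (\<exists>x w. feasible form X J0 x w)" using none dom by blast
        ultimately show ?thesis by (intro disjI2 conjI)
      qed
      with val s show "[s, y] ! 1 \<in> answers (theta form \<alpha> X) s"
        by (auto simp: theta_def)
    qed
  qed
  ultimately show ?thesis
    unfolding poly_reducible_def by blast
qed

theorem theorem7:
  fixes form :: bound_form and \<alpha> :: real and X :: "group set"
  assumes "0 \<le> \<alpha>" and "\<alpha> \<le> 1"
  shows "theta form \<alpha> (X \<union> {GrpN}) \<le>\<^sub>P theta form \<alpha> (X \<union> {GrpB, GrpN})"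
proof (cases "GrpB \<in> X")
  case True
  then have "X \<union> {GrpB, GrpN} = X \<union> {GrpN}" by auto
  then show ?thesis using theta_reducible_refl by simp
next
  case False
  then have "theta form \<alpha> (X \<union> {GrpN}) \<le>\<^sub>P theta form \<alpha> (insert GrpB (X \<union> {GrpN}))"
    by (intro theta_reducible_insert_B) auto
  then show ?thesis by (simp add: insert_commute)
qed

end
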